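(* Let $\Gamma$ be a compact Lie group acting linearly on a finite-dimensional real inner product space $V$, let $\sigma:\Gamma\to\mathbf{Z}_2=\{\pm1\}$ be an epimorphism, let $X:V\to V$ be a smooth $\Gamma$-reversible-equivariant vector field with $X(0)=0$, and let $L=(dX)_0$. Let $L^t$ be the adjoint of $L$, and assume that $e^{sL^t}\gamma=\gamma e^{\sigma(\gamma)sL^t}$ on $V$ for all $s\in\mathbb{R}$, $\gamma\in\Gamma$. Let $\mathbf{S}=\overline{\{e^{sL^t}: s\in\mathbb{R}\}}$ and let $\mathbf{S}\rtimes\Gamma$ act on $V$ by $(A,\gamma)\cdot v=A(\gamma v)$. Then for every $k\ge 2$, $$\vec{\mathcal Q}_V^k(\Gamma)=\vec{\mathcal Q}_V^k(\mathbf{S}\rtimes\Gamma)\oplus Ad_L^{\,k}\big(\vec{\mathcal P}_V^k(\Gamma)\big).$$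
   Context: A map $g:V\to V$ is $\Gamma$-equivariant if $g(\gamma x)=\gamma g(x)$, and $\Gamma$-reversible-equivariant if $g(\gamma x)=\sigma(\gamma)\gamma g(x)$, for all $\gamma\in\Gamma$, $x\in V$. $\vec{\mathcal P}_V$ is the space of polynomial mappings $V\to V$, and $\vec{\mathcal P}_V^k$ its subspace of homogeneous mappings of degree $k$. $\vec{\mathcal P}_V(\Gamma)$ and $\vec{\mathcal Q}_V(\Gamma)$ are the subspaces of $\vec{\mathcal P}_V$ of $\Gamma$-equivariant and of $\Gamma$-reversible-equivariant mappings, respectively; a superscript $k$ denotes the homogeneous part of degree $k$. The homological operator $Ad_L:\vec{\mathcal P}_V\to\vec{\mathcal P}_V$ is $Ad_L(p)(x)=(Dp)_{(x)}Lx-Lp(x)$, and $Ad_L^{\,k}$ is its restriction to $\vec{\mathcal P}_V^k$. The closure defining $\mathbf{S}$ is taken in $GL(V)$. The semidirect product $\mathbf{S}\rtimes\Gamma$ is defined by the homomorphism $\mu:\Gamma\to\mathrm{Aut}(\mathbf{S})$ with $\mu(\gamma)(e^{sL^t})=e^{\sigma(\gamma)sL^t}$ (on all of $\mathbf S$, $\mu(\gamma)$ is conjugation by $\gamma$). It carries the epimorphism $\tilde\sigma:\mathbf{S}\rtimes\Gamma\to\mathbf{Z}_2$, $\tilde\sigma(A,\gamma)=\sigma(\gamma)$. Thus $\vec{\mathcal Q}_V(\mathbf{S}\rtimes\Gamma)$ is the set of polynomial mappings $g:V\to V$ with $g(A\gamma x)=\sigma(\gamma)A\gamma g(x)$ for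 all $A\in\mathbf{S}$, $\gamma\in\Gamma$, $x\in V$, and $\vec{\mathcal Q}_V^k(\mathbf{S}\rtimes\Gamma)$ is its degree-$k$ homogeneous part. *)

theory Defs
  imports
    "HOL-Analysis.Analysis"
    "HOL-Algebra.Group_Action"
begin

section \<open>Smooth maps\<close>

text \<open>
  C^k maps on a set that is open in UNIV or, more generally, relatively open in a linear
  subspace W. In the second case the derivative is only determined along W; the
  existential lets one choose its extension to the ambient space (e.g. zero on the
  orthogonal complement of W), so this is C^k along W in the ordinary sense.
\<close>

primrec C_k_on :: "nat \<Rightarrow> 'a::real_normed_vector set \<Rightarrow> ('a \<Rightarrow> 'b::real_normed_vector) \<Rightarrow> bool"
  where
    "C_k_on 0 S f \<longleftrightarrow> continuous_on S f"
  | "C_k_on (Suc k) S f \<longleftrightarrow>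
       (\<exists>f'. (\<forall>x\<in>S. (f has_derivative f' x) (at x within S)) \<and> (\<forall>v. C_k_on k S (\<lambda>x. f' x v)))"

definition smooth_on :: "'a::real_normed_vector set \<Rightarrow> ('a \<Rightarrow> 'b::real_normed_vector) \<Rightarrow> bool"
  where "smooth_on S f \<longleftrightarrow> (\<forall>k. C_k_on k S f)"


section \<open>Compact Lie groups and linear actions\<close>

text \<open>
  A Lie group is a group with a Hausdorff second countable topology \<open>T\<close> and a smooth atlas
  \<open>\<A>\<close> for which multiplication and inversion are smooth. Charts take values in a linear
  subspace \<open>W\<close> of a Euclidean space type instead of the whole type: types of class
  \<open>euclidean_space\<close> have dimension at least one, and \<open>W = {0}\<close> is needed for
  zero-dimensional (e.g. finite) groups.
\<close>

locale lie_group = group G for G :: "('g, 'm) monoid_scheme" (structure) +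
  fixes T :: "'g topology"
    and W :: "'e::euclidean_space set"
    and \<A> :: "('g set \<times> ('g \<Rightarrow> 'e)) set"
  assumes topspace: "topspace T = carrier G"
    and Hausdorff: "Hausdorff_space T"
    and second_countable: "second_countable T"
    and subspace_model: "subspace W"
    and chart: "(U, \<phi>) \<in> \<A> \<Longrightarrow>
      openin T U \<and> openin (top_of_set W) (\<phi> ` U) \<and>
      homeomorphic_map (subtopology T U) (top_of_set (\<phi> ` U)) \<phi>"
    and charts_cover: "(\<Union>(U, \<phi>)\<in>\<A>. U) = carrier G"
    and transition_smooth: "\<lbrakk>(U, \<phi>) \<in> \<A>; (U', \<psi>) \<in> \<A>\<rbrakk> \<Longrightarrow>
      smooth_on (\<phi> ` (U \<inter> U')) (\<lambda>a. \<psi> (inv_into U \<phi> a))"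
    and mult_continuous: "continuous_map (prod_topology T T) T (\<lambda>(g, h). g \<otimes> h)"
    and mult_smooth: "\<lbrakk>(U, \<phi>) \<in> \<A>; (U', \<psi>) \<in> \<A>; (V, \<theta>) \<in> \<A>\<rbrakk> \<Longrightarrow>
      smooth_on {(\<phi> g, \<psi> h) | g h. g \<in> U \<and> h \<in> U' \<and> g \<otimes> h \<in> V}
        (\<lambda>(a, b). \<theta> (inv_into U \<phi> a \<otimes> inv_into U' \<psi> b))"
    and inv_continuous: "continuous_map T T (\<lambda>g. inv g)"
    and inv_smooth: "\<lbrakk>(U, \<phi>) \<in> \<A>; (U', \<psi>) \<in> \<A>\<rbrakk> \<Longrightarrow>
      smooth_on {\<phi> g | g. g \<in> U \<and> inv g \<in> U'} (\<lambda>a. \<psi> (inv (inv_into U \<phi> a)))"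

locale compact_lie_group = lie_group +
  assumes compact: "compact_space T"

definition linear_action ::
    "('g, 'm) monoid_scheme \<Rightarrow> 'g topology \<Rightarrow> ('g \<Rightarrow> 'v::euclidean_space \<Rightarrow> 'v) \<Rightarrow> bool"
  where "linear_action G T \<rho> \<longleftrightarrow>
    group_action G UNIV \<rho> \<and> (\<forall>\<gamma>\<in>carrier G. linear (\<rho> \<gamma>)) \<and>
    continuous_map (prod_topology T euclidean) euclidean (\<lambda>(\<gamma>, x). \<rho> \<gamma> x)"

definition Z2 :: "real monoid"
  where "Z2 = \<lparr>carrier = {-1, 1}, mult = (*), one = 1\<rparr>"


section \<open>Equivariant and reversible-equivariant polynomial mappings\<close>

definition equivariant ::
    "('h, 'm) monoid_scheme \<Rightarrow> ('h \<Rightarrow> 'v \<Rightarrow> 'v) \<Rightarrow> ('v \<Rightarrow> 'v) \<Rightarrow> bool"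
  where "equivariant H act g \<longleftrightarrow> (\<forall>h\<in>carrier H. \<forall>x. g (act h x) = act h (g x))"

definition reversible_equivariant ::
    "('h, 'm) monoid_scheme \<Rightarrow> ('h \<Rightarrow> 'v \<Rightarrow> 'v) \<Rightarrow> ('h \<Rightarrow> real) \<Rightarrow>
      ('v::real_vector \<Rightarrow> 'v) \<Rightarrow> bool"
  where "reversible_equivariant H act \<sigma> g \<longleftrightarrow>
    (\<forall>h\<in>carrier H. \<forall>x. g (act h x) = \<sigma> h *\<^sub>R act h (g x))"

definition homogeneous_polys :: "nat \<Rightarrow> ('v::euclidean_space \<Rightarrow> 'v) set"
  where "homogeneous_polys k =
    {p. polynomial_function p \<and> (\<forall>c x. p (c *\<^sub>R x) = c ^ k *\<^sub>R p x)}"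

definition equivariant_polys ::
    "nat \<Rightarrow> ('h, 'm) monoid_scheme \<Rightarrow> ('h \<Rightarrow> 'v \<Rightarrow> 'v) \<Rightarrow> ('v::euclidean_space \<Rightarrow> 'v) set"
  where "equivariant_polys k H act = {p \<in> homogeneous_polys k. equivariant H act p}"

definition reversible_equivariant_polys ::
    "nat \<Rightarrow> ('h, 'm) monoid_scheme \<Rightarrow> ('h \<Rightarrow> 'v \<Rightarrow> 'v) \<Rightarrow> ('h \<Rightarrow> real) \<Rightarrow>
      ('v::euclidean_space \<Rightarrow> 'v) set"
  where "reversible_equivariant_polys k H act \<sigma> =
    {p \<in> homogeneous_polys k. reversible_equivariant H act \<sigma> p}"

definition Ad ::
    "('v::euclidean_space \<Rightarrow>\<^sub>L 'v) \<Rightarrow> ('v \<Rightarrow> 'v) \<Rightarrow> ('v \<Rightarrow> 'v)"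
  where "Ad L p = (\<lambda>x. frechet_derivative p (at x) (L x) - L (p x))"


section \<open>The group S and its semidirect product with \<open>\<Gamma>\<close>\<close>

text \<open>
  \<open>'v \<Rightarrow>\<^sub>L 'v\<close> is not an instance of the type classes required by \<^const>\<open>exp\<close>,
  so the exponential series is written out with composition as multiplication.
\<close>

definition blinfun_exp :: "('v::banach \<Rightarrow>\<^sub>L 'v) \<Rightarrow> ('v \<Rightarrow>\<^sub>L 'v)"
  where "blinfun_exp A = (\<Sum>n. (((o\<^sub>L) A ^^ n) id_blinfun) /\<^sub>R fact n)"

definition blinfun_adjoint :: "('v::euclidean_space \<Rightarrow>\<^sub>L 'v) \<Rightarrow> ('v \<Rightarrow>\<^sub>L 'v)"
  where "blinfun_adjoint A = Blinfun (adjoint (blinfun_apply A))"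

definition GL :: "('v::euclidean_space \<Rightarrow>\<^sub>L 'v) set"
  where "GL = {A. bij (blinfun_apply A)}"

definition S_group :: "('v::euclidean_space \<Rightarrow>\<^sub>L 'v) \<Rightarrow> ('v \<Rightarrow>\<^sub>L 'v) monoid"
  where "S_group L =
    \<lparr>carrier = top_of_set GL closure_of range (\<lambda>s. blinfun_exp (s *\<^sub>R blinfun_adjoint L)),
     mult = (o\<^sub>L), one = id_blinfun\<rparr>"

definition semidirect_product ::
    "('a, 'm) monoid_scheme \<Rightarrow> ('g, 'n) monoid_scheme \<Rightarrow> ('g \<Rightarrow> 'a \<Rightarrow> 'a) \<Rightarrow> ('a \<times> 'g) monoid"
  where "semidirect_product K G \<mu> =
    \<lparr>carrier = carrier K \<times> carrier G,
     mult = (\<lambda>(a, g) (b, h). (a \<otimes>\<^bsub>K\<^esub> \<mu> g b, g \<otimes>\<^bsub>G\<^esub> h)),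
     one = (\<one>\<^bsub>K\<^esub>, \<one>\<^bsub>G\<^esub>)\<rparr>"

definition conjugation ::
    "('g, 'm) monoid_scheme \<Rightarrow> ('g \<Rightarrow> 'v::euclidean_space \<Rightarrow> 'v) \<Rightarrow>
      'g \<Rightarrow> ('v \<Rightarrow>\<^sub>L 'v) \<Rightarrow> ('v \<Rightarrow>\<^sub>L 'v)"
  where "conjugation G \<rho> \<gamma> A = Blinfun (\<lambda>x. \<rho> \<gamma> (A (\<rho> (inv\<^bsub>G\<^esub> \<gamma>) x)))"

definition S_semidirect ::
    "('v::euclidean_space \<Rightarrow>\<^sub>L 'v) \<Rightarrow> ('g, 'm) monoid_scheme \<Rightarrow> ('g \<Rightarrow> 'v \<Rightarrow> 'v) \<Rightarrow>
      (('v \<Rightarrow>\<^sub>L 'v) \<times> 'g) monoid"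
  where "S_semidirect L G \<rho> = semidirect_product (S_group L) G (conjugation G \<rho>)"

definition semidirect_action ::
    "('g \<Rightarrow> 'v \<Rightarrow> 'v) \<Rightarrow> ('v::euclidean_space \<Rightarrow>\<^sub>L 'v) \<times> 'g \<Rightarrow> 'v \<Rightarrow> 'v"
  where "semidirect_action \<rho> = (\<lambda>(A, \<gamma>) v. A (\<rho> \<gamma> v))"

definition semidirect_sign :: "('g \<Rightarrow> real) \<Rightarrow> ('v::euclidean_space \<Rightarrow>\<^sub>L 'v) \<times> 'g \<Rightarrow> real"
  where "semidirect_sign \<sigma> = (\<lambda>(A, \<gamma>). \<sigma> \<gamma>)"


section \<open>Internal direct sums of spaces of maps\<close>

definition map_subspace :: "('a \<Rightarrow> 'b::real_vector) set \<Rightarrow> bool"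
  where "map_subspace F \<longleftrightarrow>
    (\<lambda>x. 0) \<in> F \<and> (\<forall>f\<in>F. \<forall>g\<in>F. (\<lambda>x. f x + g x) \<in> F) \<and> (\<forall>c. \<forall>f\<in>F. (\<lambda>x. c *\<^sub>R f x) \<in> F)"

definition is_direct_sum ::
    "('a \<Rightarrow> 'b::real_vector) set \<Rightarrow> ('a \<Rightarrow> 'b) set \<Rightarrow> ('a \<Rightarrow> 'b) set \<Rightarrow> bool"
  where "is_direct_sum E F F' \<longleftrightarrow>
    map_subspace F \<and> map_subspace F' \<and>
    E = {(\<lambda>x. f x + f' x) | f f'. f \<in> F \<and> f' \<in> F'} \<and> F \<inter> F' = {\<lambda>x. 0}"

end

theory Submission
  imports Defs
begin

text \<open>
  The inner product on homogeneous mappings of degree \<open>k\<close> that pairs their \<open>k\<close>-th derivatives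
  makes \<open>Ad L\<close> and \<open>Ad L\<^sup>t\<close> adjoint, so that the homogeneous mappings split as
  \<open>ker (Ad L\<^sup>t) \<oplus> im (Ad L)\<close> and also as \<open>ker (Ad L) \<oplus> im (Ad L\<^sup>t)\<close>. Differentiating \<open>X\<close> and the
  commutation hypothesis shows that \<open>L\<close> and \<open>L\<^sup>t\<close> commute with each \<open>\<gamma>\<close> up to the sign \<open>\<sigma> \<gamma>\<close>;
  conjugation by \<open>\<gamma>\<close> therefore preserves all four subspaces. Writing \<open>q = a + Ad L p\<close> with
  \<open>a\<close> in the kernel of \<open>Ad L\<^sup>t\<close> and \<open>p\<close> in its image, \<open>a\<close> and \<open>p\<close> are unique and inherit their symmetry
  from that of \<open>q\<close>, so no averaging over \<open>\<Gamma>\<close> is needed. Finally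
  the kernel of \<open>Ad L\<^sup>t\<close> consists of the mappings that commute with the flow \<open>s \<mapsto> exp (s L\<^sup>t)\<close>,
  hence with its closure.
\<close>

section \<open>Derivatives of polynomial mappings\<close>

text \<open>
  First and second directional derivatives are constructed together because the
  symmetry of \<open>E\<close> for a product rests on the product rule for \<open>D\<close>.
\<close>

lemma real_polynomial_function_derivatives:
  fixes f :: "'a::real_normed_vector \<Rightarrow> real"
  assumes "real_polynomial_function f"
  shows "\<exists>D E. (\<forall>x. (f has_derivative (\<lambda>v. D v x)) (at x)) \<and> (\<forall>v. real_polynomial_function (D v)) \<and>
    (\<forall>v x. (D v has_derivative (\<lambda>u. E u v x)) (at x)) \<and> (\<forall>u v x. E u v x = E v u x)"
  using assms
proof induction
  case (linear f)
  show ?case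
    by (rule exI[of _ "\<lambda>v x. f v"], rule exI[of _ "\<lambda>u v x. 0"])
      (use linear in \<open>auto intro: bounded_linear_imp_has_derivative\<close>)
next
  case (const c)
  show ?case
    by (rule exI[of _ "\<lambda>v x. 0"], rule exI[of _ "\<lambda>u v x. 0"]) auto
next
  case (add f g)
  obtain D E where f: "\<And>x. (f has_derivative (\<lambda>v. D v x)) (at x)" "\<And>v. real_polynomial_function (D v)"
      "\<And>v x. (D v has_derivative (\<lambda>u. E u v x)) (at x)" "\<And>u v x. E u v x = E v u x"
    using add.IH(1) by blast
  obtain D' E' where g: "\<And>x. (g has_derivative (\<lambda>v. D' v x)) (at x)" "\<And>v. real_polynomial_function (D' v)"
      "\<And>v x. (D' v has_derivative (\<lambda>u. E' u v x)) (at x)" "\<And>u v x. E' u v x = E' v u x"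
    using add.IH(2) by blast
  let ?D = "\<lambda>v x. D v x + D' v x"
  let ?E = "\<lambda>u v x. E u v x + E' u v x"
  have "((\<lambda>x. f x + g x) has_derivative (\<lambda>v. ?D v x)) (at x)" for x
    by (intro has_derivative_add f g)
  moreover have "real_polynomial_function (?D v)" for v
    by (intro real_polynomial_function.intros(3) f g)
  moreover have "(?D v has_derivative (\<lambda>u. ?E u v x)) (at x)" for v x
    by (intro has_derivative_add f g)
  moreover have "?E u v x = ?E v u x" for u v x
    by (simp add: f(4)[of u v] g(4)[of u v])
  ultimately show ?case
    by (intro exI[of _ ?D] exI[of _ ?E]) blast
next
  case (mult f g)
  obtain D E where f: "\<And>x. (f has_derivative (\<lambda>v. D v x)) (at x)" "\<And>v. real_polynomial_function (D v)"
      "\<And>v x. (D v has_derivative (\<lambda>u. E u v x)) (at x)" "\<And>u v x. E u v x = E v u x"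
    using mult.IH(1) by blast
  obtain D' E' where g: "\<And>x. (g has_derivative (\<lambda>v. D' v x)) (at x)" "\<And>v. real_polynomial_function (D' v)"
      "\<And>v x. (D' v has_derivative (\<lambda>u. E' u v x)) (at x)" "\<And>u v x. E' u v x = E' v u x"
    using mult.IH(2) by blast
  let ?D = "\<lambda>v x. f x * D' v x + D v x * g x"
  let ?E = "\<lambda>u v x. (f x * E' u v x + D u x * D' v x) + (D v x * D' u x + E u v x * g x)"
  have "((\<lambda>x. f x * g x) has_derivative (\<lambda>v. ?D v x)) (at x)" for x
    by (intro has_derivative_mult f g)
  moreover have "real_polynomial_function (?D v)" for v
    by (intro real_polynomial_function.intros(3,4) f g mult.hyps)
  moreover have "(?D v has_derivative (\<lambda>u. ?E u v x)) (at x)" for v x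
    by (intro has_derivative_add has_derivative_mult f g)
  moreover have "?E u v x = ?E v u x" for u v x
    by (simp add: f(4)[of u v] g(4)[of u v])
  ultimately show ?case
    by (intro exI[of _ ?D] exI[of _ ?E]) blast
qed

text \<open>The direction comes before the map so that \<open>dir_deriv v\<close> is an operator on
  maps and can be iterated.\<close>

definition dir_deriv :: "'a::real_normed_vector \<Rightarrow> ('a \<Rightarrow> 'b::real_normed_vector) \<Rightarrow> 'a \<Rightarrow> 'b"
  where "dir_deriv v p x = frechet_derivative p (at x) v"

lemma dir_deriv_eq:
  assumes "(p has_derivative D) (at x)"
  shows "dir_deriv v p x = D v"
  unfolding dir_deriv_def using frechet_derivative_at[OF assms] by simp

lemma polynomial_has_derivative:
  fixes p :: "'a::euclidean_space \<Rightarrow> 'b::euclidean_space"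
  assumes "polynomial_function p"
  shows "(p has_derivative (\<lambda>v. dir_deriv v p x)) (at x)"
  unfolding dir_deriv_def using differentiable_at_polynomial_function[OF assms]
  by (simp add: frechet_derivative_works)

lemma dir_deriv_inner:
  fixes p :: "'a::euclidean_space \<Rightarrow> 'b::euclidean_space"
  assumes "polynomial_function p"
  shows "dir_deriv v (\<lambda>x. p x \<bullet> b) x = dir_deriv v p x \<bullet> b"
  by (rule dir_deriv_eq) (intro has_derivative_inner_left polynomial_has_derivative assms)

lemma
  fixes f :: "'a::euclidean_space \<Rightarrow> real"
  assumes "real_polynomial_function f"
  shows real_polynomial_dir_deriv: "real_polynomial_function (dir_deriv v f)"
    and real_dir_deriv_commute: "dir_deriv u (dir_deriv v f) x = dir_deriv v (dir_deriv u f) x"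
proof -
  obtain D E where D: "\<And>x. (f has_derivative (\<lambda>v. D v x)) (at x)" "\<And>v. real_polynomial_function (D v)"
      "\<And>v x. (D v has_derivative (\<lambda>u. E u v x)) (at x)" "\<And>u v x. E u v x = E v u x"
    using real_polynomial_function_derivatives[OF assms] by blast
  have eq: "dir_deriv v f = D v" for v
    using dir_deriv_eq[OF D(1)] by auto
  show "real_polynomial_function (dir_deriv v f)"
    by (simp add: eq D)
  show "dir_deriv u (dir_deriv v f) x = dir_deriv v (dir_deriv u f) x"
    unfolding eq dir_deriv_eq[OF D(3)] by (rule D(4))
qed

lemma polynomial_dir_deriv:
  fixes p :: "'a::euclidean_space \<Rightarrow> 'b::euclidean_space"
  assumes "polynomial_function p"
  shows "polynomial_function (dir_deriv v p)"
  unfolding polynomial_function_iff_Basis_inner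
proof
  fix b :: 'b assume "b \<in> Basis"
  have "real_polynomial_function (\<lambda>x. p x \<bullet> b)"
    using assms by (simp add: real_polynomial_function_eq polynomial_function_inner)
  from real_polynomial_dir_deriv[OF this, of v]
  show "real_polynomial_function (\<lambda>x. dir_deriv v p x \<bullet> b)"
    using dir_deriv_inner[OF assms] by (metis (no_types, lifting) ext)
qed

lemma dir_deriv_commute:
  fixes p :: "'a::euclidean_space \<Rightarrow> 'b::euclidean_space"
  assumes "polynomial_function p"
  shows "dir_deriv u (dir_deriv v p) x = dir_deriv v (dir_deriv u p) x"
proof (rule euclidean_eqI)
  fix b :: 'b assume "b \<in> Basis"
  have "real_polynomial_function (\<lambda>x. p x \<bullet> b)"
    using assms by (simp add: real_polynomial_function_eq polynomial_function_inner)
  from real_dir_deriv_commute[OF this, of u v x]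
  show "dir_deriv u (dir_deriv v p) x \<bullet> b = dir_deriv v (dir_deriv u p) x \<bullet> b"
    using dir_deriv_inner[OF assms] dir_deriv_inner[OF polynomial_dir_deriv[OF assms]]
    by (metis (no_types, lifting) ext)
qed

lemma dir_deriv_add:
  fixes p q :: "'a::euclidean_space \<Rightarrow> 'b::euclidean_space"
  assumes "polynomial_function p" "polynomial_function q"
  shows "dir_deriv v (\<lambda>x. p x + q x) = (\<lambda>x. dir_deriv v p x + dir_deriv v q x)"
  by (rule ext, rule dir_deriv_eq) (intro has_derivative_add polynomial_has_derivative assms)

lemma dir_deriv_compose_linear:
  fixes p :: "'a::euclidean_space \<Rightarrow> 'b::euclidean_space"
  assumes "polynomial_function p" "bounded_linear h"
  shows "dir_deriv v (\<lambda>x. h (p x)) = (\<lambda>x. h (dir_deriv v p x))"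
  by (rule ext, rule dir_deriv_eq)
    (intro bounded_linear.has_derivative[OF assms(2)] polynomial_has_derivative assms)

lemma dir_deriv_scaleR:
  fixes p :: "'a::euclidean_space \<Rightarrow> 'b::euclidean_space"
  assumes "polynomial_function p"
  shows "dir_deriv v (\<lambda>x. c *\<^sub>R p x) = (\<lambda>x. c *\<^sub>R dir_deriv v p x)"
  by (rule dir_deriv_compose_linear[OF assms bounded_linear_scaleR_right])

text \<open>Turns a direction that varies with the point, such as \<open>h x\<close>, into fixed
  directions with scalar coefficients that can themselves be differentiated.\<close>

lemma dir_deriv_sum_basis:
  fixes p :: "'a::euclidean_space \<Rightarrow> 'b::euclidean_space"
  assumes "polynomial_function p"
  shows "dir_deriv v p x = (\<Sum>i\<in>Basis. (v \<bullet> i) *\<^sub>R dir_deriv i p x)"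
proof -
  have lin: "linear (\<lambda>v. dir_deriv v p x)"
    using polynomial_has_derivative[OF assms] by (rule has_derivative_linear)
  show ?thesis
    by (subst (1) euclidean_representation[symmetric, of v])
      (simp add: linear_sum[OF lin] linear_cmul[OF lin])
qed

section \<open>Homogeneous mappings: scaling of derivatives and Euler's identity\<close>

lemma homogeneous_polysD:
  assumes "p \<in> homogeneous_polys k"
  shows "polynomial_function p" "p (c *\<^sub>R x) = c ^ k *\<^sub>R p x"
  using assms by (auto simp: homogeneous_polys_def)

text \<open>Differentiate both sides of the scaling law of \<open>p\<close> at \<open>x\<close>.
  Scaling the direction together with the point keeps the exponent at \<open>k\<close> and avoids
  dividing by \<open>c\<close>.\<close>

lemma homogeneous_dir_deriv_scaleR:
  assumes p: "p \<in> homogeneous_polys k"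
  shows "dir_deriv (c *\<^sub>R v) p (c *\<^sub>R x) = c ^ k *\<^sub>R dir_deriv v p x"
proof -
  note poly = homogeneous_polysD(1)[OF p]
  have "((\<lambda>y. p (c *\<^sub>R y)) has_derivative (\<lambda>v. dir_deriv (c *\<^sub>R v) p (c *\<^sub>R x))) (at x)"
    by (rule has_derivative_compose[of "\<lambda>y. c *\<^sub>R y", OF _ polynomial_has_derivative[OF poly]])
      (auto intro!: derivative_eq_intros)
  moreover have "((\<lambda>y. p (c *\<^sub>R y)) has_derivative (\<lambda>v. c ^ k *\<^sub>R dir_deriv v p x)) (at x)"
    unfolding homogeneous_polysD(2)[OF p]
    by (intro has_derivative_scaleR_right polynomial_has_derivative poly)
  ultimately show ?thesis
    by (metis has_derivative_unique)
qed

lemma homogeneous_dir_deriv: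
  assumes p: "p \<in> homogeneous_polys (Suc k)"
  shows "dir_deriv v p \<in> homogeneous_polys k"
proof -
  note poly = homogeneous_polysD(1)[OF p]
  note dpoly = polynomial_dir_deriv[OF poly, of v]
  have lin: "linear (\<lambda>v. dir_deriv v p x)" for x
    using polynomial_has_derivative[OF poly] by (rule has_derivative_linear)
  have nz: "dir_deriv v p (c *\<^sub>R x) = c ^ k *\<^sub>R dir_deriv v p x" if "c \<noteq> 0" for c x
  proof -
    have "c *\<^sub>R dir_deriv v p (c *\<^sub>R x) = c *\<^sub>R (c ^ k *\<^sub>R dir_deriv v p x)"
      using homogeneous_dir_deriv_scaleR[OF p, of c v x] by (simp add: linear_cmul[OF lin])
    with that show ?thesis by (metis scaleR_cancel_left)
  qed
  have "dir_deriv v p (c *\<^sub>R x) = c ^ k *\<^sub>R dir_deriv v p x" for c x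
  proof (cases "c = 0")
    \<comment> \<open>Here \<open>c\<close> cannot be cancelled. Both sides are continuous in the
      scale \<open>t\<close> and agree for \<open>t \<noteq> 0\<close>, hence also at
      \<open>0\<close>; this includes \<open>k = 0\<close>, where \<open>0 ^ 0 = 1\<close>.\<close>
    case True
    let ?d = "\<lambda>t::real. dir_deriv v p (t *\<^sub>R x) - t ^ k *\<^sub>R dir_deriv v p x"
    have "isCont (dir_deriv v p) y" for y
      using polynomial_has_derivative[OF dpoly] by (rule has_derivative_continuous)
    then have "isCont ?d 0"
      by (intro continuous_intros isCont_o2[of _ "\<lambda>t. t *\<^sub>R x" "dir_deriv v p"]) auto
    then have "?d \<midarrow>0\<rightarrow> ?d 0"
      by (simp add: isCont_def)
    moreover have "?d \<midarrow>0\<rightarrow> 0"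
      by (rule Lim_transform_eventually[OF tendsto_const]) (auto simp: eventually_at_filter nz)
    ultimately have "?d 0 = 0"
      by (rule LIM_unique)
    with True show ?thesis by simp
  qed (rule nz)
  with dpoly show ?thesis
    by (simp add: homogeneous_polys_def)
qed

text \<open>Compare two derivatives of \<open>t \<mapsto> p (t *\<^sub>R x)\<close> at
  \<open>t = 1\<close>: one from the chain rule, one from the scaling law.\<close>

lemma Euler_homogeneous:
  assumes p: "p \<in> homogeneous_polys k"
  shows "dir_deriv x p x = real k *\<^sub>R p x"
proof -
  note poly = homogeneous_polysD(1)[OF p]
  have "((\<lambda>t. p (t *\<^sub>R x)) has_derivative (\<lambda>t. dir_deriv (t *\<^sub>R x) p (1 *\<^sub>R x))) (at 1)"
    by (rule has_derivative_compose[of "\<lambda>t. t *\<^sub>R x", OF _ polynomial_has_derivative[OF poly]])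
      (auto intro!: derivative_eq_intros)
  moreover have "((\<lambda>t. p (t *\<^sub>R x)) has_derivative (\<lambda>t. (real k * t) *\<^sub>R p x)) (at 1)"
    unfolding homogeneous_polysD(2)[OF p]
    by (auto intro!: derivative_eq_intros)
  ultimately have "(\<lambda>t. dir_deriv (t *\<^sub>R x) p (1 *\<^sub>R x)) = (\<lambda>t. (real k * t) *\<^sub>R p x)"
    by (rule has_derivative_unique)
  from fun_cong[OF this, of 1] show ?thesis by simp
qed

section \<open>Orthogonal splittings for adjoint maps\<close>

lemma map_subspaceD:
  assumes "map_subspace F"
  shows "(\<lambda>x. 0) \<in> F"
    and "f \<in> F \<Longrightarrow> g \<in> F \<Longrightarrow> (\<lambda>x. f x + g x) \<in> F"
    and "f \<in> F \<Longrightarrow> (\<lambda>x. c *\<^sub>R f x) \<in> F"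
  using assms by (auto simp: map_subspace_def)

lemma map_subspace_diff:
  assumes "map_subspace F" "f \<in> F" "g \<in> F"
  shows "(\<lambda>x. f x - g x) \<in> F"
  using map_subspaceD(2)[OF assms(1,2) map_subspaceD(3)[OF assms(1,3), of "-1"]] by simp

lemma map_subspace_sum:
  assumes "map_subspace F" "\<And>i. i \<in> I \<Longrightarrow> f i \<in> F"
  shows "(\<lambda>x. \<Sum>i\<in>I. f i x) \<in> F"
  using assms(2)
proof (induction I rule: infinite_finite_induct)
  case (insert i I)
  then show ?case
    using map_subspaceD(2)[OF assms(1), of "f i" "\<lambda>x. \<Sum>i\<in>I. f i x"] by simp
qed (simp_all add: map_subspaceD(1)[OF assms(1)])

text \<open>\<open>map_subspace hull B\<close> serves as the linear span of \<open>B\<close> inside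
  the space of maps; an intersection of subspaces is a subspace.\<close>

lemma map_subspace_hull: "map_subspace (map_subspace hull B)"
  by (rule hull_in) (auto simp: map_subspace_def)

text \<open>The laws are relative to \<open>U\<close> because the Fischer form of order
  \<open>k\<close> degenerates on polynomials of lower degree. Linearity in the second argument
  follows by symmetry.\<close>

locale map_inner_product =
  fixes U :: "('a \<Rightarrow> 'b::real_vector) set"
    and ip :: "('a \<Rightarrow> 'b) \<Rightarrow> ('a \<Rightarrow> 'b) \<Rightarrow> real"
  assumes subspace: "map_subspace U"
    and ip_add: "\<lbrakk>p \<in> U; q \<in> U; r \<in> U\<rbrakk> \<Longrightarrow> ip (\<lambda>x. p x + q x) r = ip p r + ip q r"
    and ip_scaleR: "\<lbrakk>p \<in> U; r \<in> U\<rbrakk> \<Longrightarrow> ip (\<lambda>x. c *\<^sub>R p x) r = c * ip p r"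
    and ip_commute: "\<lbrakk>p \<in> U; q \<in> U\<rbrakk> \<Longrightarrow> ip p q = ip q p"
    and ip_definite: "\<lbrakk>p \<in> U; ip p p = 0\<rbrakk> \<Longrightarrow> p = (\<lambda>x. 0)"
begin

lemma ip_diff:
  assumes "p \<in> U" "q \<in> U" "r \<in> U"
  shows "ip (\<lambda>x. p x - q x) r = ip p r - ip q r"
  using ip_add[OF assms(1) map_subspaceD(3)[OF subspace assms(2), of "-1"] assms(3)]
    ip_scaleR[OF assms(2,3), of "-1"] by simp

lemma ip_zero: "r \<in> U \<Longrightarrow> ip (\<lambda>x. 0) r = 0"
  using ip_scaleR[OF map_subspaceD(1)[OF subspace], of r 0] by simp

lemma hull_subset_U: "B \<subseteq> U \<Longrightarrow> map_subspace hull B \<subseteq> U"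
  by (rule hull_minimal) (auto simp: subspace)

text \<open>Gram-Schmidt over the generators: the residuals of \<open>q\<close> and of the new
  generator \<open>b\<close> relative to the span of \<open>B\<close> are both orthogonal to
  \<open>B\<close>, so a multiple of the second corrects the first without spoiling the earlier
  conditions. The generators may be dependent.\<close>

lemma orthogonal_projection:
  assumes "finite B" "B \<subseteq> U" "q \<in> U"
  shows "\<exists>p\<in>map_subspace hull B. \<forall>b\<in>B. ip (\<lambda>x. q x - p x) b = 0"
  using assms
proof (induction B arbitrary: q)
  case empty
  show ?case
    using map_subspaceD(1)[OF map_subspace_hull, of "{}"] by auto
next
  case (insert b B)
  then have b: "b \<in> U" and BU: "B \<subseteq> U" by auto
  obtain p where p: "p \<in> map_subspace hull B" "\<forall>c\<in>B. ip (\<lambda>x. q x - p x) c = 0"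
    using insert.IH[OF BU insert.prems(2)] by blast
  obtain b' where b': "b' \<in> map_subspace hull B" "\<forall>c\<in>B. ip (\<lambda>x. b x - b' x) c = 0"
    using insert.IH[OF BU b] by blast
  let ?q = "\<lambda>x. q x - p x" and ?b = "\<lambda>x. b x - b' x"
  \<comment> \<open>Chosen so that the corrected residual pairs to zero with \<open>b\<close>. If
    the denominator vanishes, division by zero makes \<open>?t\<close> equal to
    \<open>0\<close>.\<close>
  let ?t = "ip ?q b / ip ?b b"
  let ?p = "\<lambda>x. p x + ?t *\<^sub>R ?b x"
  have pU: "p \<in> U" "b' \<in> U"
    using p(1) b'(1) hull_subset_U[OF BU] by auto
  have qU: "?q \<in> U" and bU: "?b \<in> U"
    using map_subspace_diff[OF subspace] insert.prems(2) b pU by auto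
  have hull: "p \<in> map_subspace hull (insert b B)" "b' \<in> map_subspace hull (insert b B)"
    using p(1) b'(1) hull_mono[of B "insert b B" map_subspace] by auto
  have "?p \<in> map_subspace hull (insert b B)"
    by (intro map_subspaceD(2,3)[OF map_subspace_hull] map_subspace_diff[OF map_subspace_hull] hull
        hull_inc insertI1)
  moreover have eq: "ip (\<lambda>x. q x - ?p x) c = ip ?q c - ?t * ip ?b c" if "c \<in> U" for c
    using ip_diff[OF qU map_subspaceD(3)[OF subspace bU, of ?t] that] ip_scaleR[OF bU that, of ?t]
    by (simp add: diff_diff_eq)
  moreover have "ip ?q b - ?t * ip ?b b = 0"
  proof (cases "ip ?b b = 0")
    \<comment> \<open>A dependent generator: \<open>?b\<close> is orthogonal to \<open>b'\<close> as
      well as to \<open>b\<close>, so it is zero by definiteness and \<open>b\<close> already lies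
      in the span of \<open>B\<close>, to which \<open>?q\<close> is orthogonal.\<close>
    case True
    have "{u \<in> U. ip ?b u = 0} \<supseteq> map_subspace hull B"
    proof (rule hull_minimal)
      show "map_subspace {u \<in> U. ip ?b u = 0}"
        using subspace ip_add ip_scaleR ip_commute[OF bU] ip_zero bU by (auto simp: map_subspace_def)
    qed (use b'(2) BU in auto)
    with b'(1) have "ip ?b b' = 0" by auto
    with True have "ip ?b ?b = 0"
      using ip_diff[OF b pU(2) bU] ip_commute[OF bU] b pU(2) by simp
    then have "?b = (\<lambda>x. 0)"
      by (rule ip_definite[OF bU])
    then have "b = b'"
      by (simp add: fun_eq_iff)
    have "{u \<in> U. ip ?q u = 0} \<supseteq> map_subspace hull B"
    proof (rule hull_minimal)
      show "map_subspace {u \<in> U. ip ?q u = 0}"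
        using subspace ip_add ip_scaleR ip_commute[OF qU] ip_zero qU by (auto simp: map_subspace_def)
    qed (use p(2) BU in auto)
    with b'(1) \<open>b = b'\<close> have "ip ?q b = 0" by auto
    then show ?thesis by simp
  qed simp
  ultimately show ?case
    using p(2) b'(2) b BU by (intro bexI[of _ ?p]) (auto simp: subset_iff)
qed

end

text \<open>Abstracts the pair \<open>Ad L\<close>, \<open>Ad L\<^sup>t\<close>, to be used in both
  orders. The finite set of generators brings projection onto the image of \<open>A\<close> within
  reach of \<open>orthogonal_projection\<close>.\<close>

locale adjoint_maps = map_inner_product U ip
  for U :: "('a \<Rightarrow> 'b::real_vector) set" and ip +
  fixes A A' :: "('a \<Rightarrow> 'b) \<Rightarrow> ('a \<Rightarrow> 'b)" and B
  assumes A_in: "p \<in> U \<Longrightarrow> A p \<in> U" and A'_in: "p \<in> U \<Longrightarrow> A' p \<in> U"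
    and A_add: "\<lbrakk>p \<in> U; q \<in> U\<rbrakk> \<Longrightarrow> A (\<lambda>x. p x + q x) = (\<lambda>x. A p x + A q x)"
    and A_scaleR: "p \<in> U \<Longrightarrow> A (\<lambda>x. c *\<^sub>R p x) = (\<lambda>x. c *\<^sub>R A p x)"
    and adjoint: "\<lbrakk>p \<in> U; q \<in> U\<rbrakk> \<Longrightarrow> ip (A p) q = ip p (A' q)"
    and finite_generators: "finite B" and generators: "map_subspace hull B = U"
begin

text \<open>By adjointness \<open>ip (A p) (A p) = ip p (A' (A p))\<close>, and the right side
  vanishes.\<close>

lemma kernel_image_trivial:
  assumes "p \<in> U" "A' (A p) = (\<lambda>x. 0)"
  shows "A p = (\<lambda>x. 0)"
proof (rule ip_definite)
  show "ip (A p) (A p) = 0"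
    unfolding adjoint[OF assms(1) A_in[OF assms(1)]] assms(2)
    using ip_commute[OF assms(1) map_subspaceD(1)[OF subspace]] ip_zero[OF assms(1)] by simp
qed (rule A_in[OF assms(1)])

lemma kernel_image_sum:
  assumes q: "q \<in> U"
  shows "\<exists>a\<in>U. \<exists>p\<in>U. A' a = (\<lambda>x. 0) \<and> q = (\<lambda>x. a x + A p x)"
proof -
  have "B \<subseteq> U"
    using hull_subset[of B map_subspace] by (simp add: generators)
  then have AB: "A ` B \<subseteq> U" "A ` B \<subseteq> A ` U"
    using A_in by auto
  \<comment> \<open>Project onto the span of the images of the generators. That span lies in the
    image of \<open>A\<close>, so \<open>g\<close> has a preimage \<open>p\<close>, and
    \<open>q - g\<close> will be the kernel part.\<close>
  obtain g where g: "g \<in> map_subspace hull (A ` B)" "\<forall>b\<in>A ` B. ip (\<lambda>x. q x - g x) b = 0"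
    using orthogonal_projection[OF finite_imageI[OF finite_generators] AB(1) q] by (elim bexE)
  have A_zero: "A (\<lambda>x. 0) = (\<lambda>x. 0)"
    using A_scaleR[OF map_subspaceD(1)[OF subspace], of 0] by simp
  have "map_subspace (A ` U)"
    unfolding map_subspace_def ball_simps
  proof (intro conjI ballI allI)
    show "(\<lambda>x. 0) \<in> A ` U"
      using A_zero map_subspaceD(1)[OF subspace] by (metis image_eqI)
    show "(\<lambda>x. A p x + A q x) \<in> A ` U" if "p \<in> U" "q \<in> U" for p q
      using A_add[OF that] map_subspaceD(2)[OF subspace that] by (metis image_eqI)
    show "(\<lambda>x. c *\<^sub>R A p x) \<in> A ` U" if "p \<in> U" for c p
      using A_scaleR[OF that, of c] map_subspaceD(3)[OF subspace that, of c] by (metis image_eqI)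
  qed
  from hull_minimal[where S = map_subspace, OF AB(2) this] g(1)
  obtain p where p: "p \<in> U" "g = A p"
    by auto
  define a where "a = (\<lambda>x. q x - g x)"
  have a: "a \<in> U"
    unfolding a_def using map_subspace_diff[OF subspace q] p A_in by auto
  \<comment> \<open>The projection gives this for \<open>u\<close> in \<open>B\<close>; the
    condition is linear in \<open>u\<close>, so it extends to \<open>U\<close>.\<close>
  have orth: "ip a (A u) = 0" if "u \<in> U" for u
  proof -
    have "{u \<in> U. ip a (A u) = 0} \<supseteq> map_subspace hull B"
    proof (rule hull_minimal)
      show "map_subspace {u \<in> U. ip a (A u) = 0}"
        using subspace a A_in
        by (auto simp: map_subspace_def A_zero A_add A_scaleR ip_commute[OF a] ip_add ip_scaleR ip_zero)
    qed (use g(2) \<open>B \<subseteq> U\<close> in \<open>auto simp: a_def\<close>)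
    with that generators show ?thesis by auto
  qed
  \<comment> \<open>Take \<open>u = A' a\<close>: then
    \<open>ip (A' a) (A' a) = ip (A (A' a)) a\<close>, and the right side is zero.\<close>
  have "ip (A' a) (A' a) = 0"
    using adjoint[OF A'_in[OF a] a] orth[OF A'_in[OF a]] ip_commute[OF a A_in[OF A'_in[OF a]]]
    by simp
  then have "A' a = (\<lambda>x. 0)"
    by (rule ip_definite[OF A'_in[OF a]])
  with a p show ?thesis
    by (intro bexI[of _ a] bexI[of _ p]) (auto simp: a_def)
qed

end

section \<open>The Fischer inner product\<close>

text \<open>For mappings of degree \<open>k\<close> the \<open>k\<close>-th derivatives are constant; evaluation at \<open>0\<close> only makes the definition total.\<close>

primrec fischer :: "nat \<Rightarrow> ('a::euclidean_space \<Rightarrow> 'b::euclidean_space) \<Rightarrow> ('a \<Rightarrow> 'b) \<Rightarrow> real"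
  where
    "fischer 0 p q = p 0 \<bullet> q 0"
  | "fischer (Suc k) p q = (\<Sum>i\<in>Basis. fischer k (dir_deriv i p) (dir_deriv i q))"

lemma fischer_commute: "fischer k p q = fischer k q p"
proof (induction k arbitrary: p q)
  case (Suc k)
  show ?case unfolding fischer.simps by (subst Suc.IH) simp
qed (simp add: inner_commute)

lemma fischer_add_left:
  assumes "polynomial_function p" "polynomial_function q"
  shows "fischer k (\<lambda>x. p x + q x) r = fischer k p r + fischer k q r"
  using assms
  by (induction k arbitrary: p q r)
    (simp_all add: inner_add_left dir_deriv_add polynomial_dir_deriv sum.distrib)

lemma fischer_scaleR_left:
  assumes "polynomial_function p"
  shows "fischer k (\<lambda>x. c *\<^sub>R p x) r = c * fischer k p r"
  using assms
  by (induction k arbitrary: p r)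
    (simp_all add: dir_deriv_scaleR polynomial_dir_deriv sum_distrib_left)

lemma fischer_sum_left:
  assumes "\<And>i. i \<in> I \<Longrightarrow> polynomial_function (p i)"
  shows "fischer k (\<lambda>x. \<Sum>i\<in>I. c i *\<^sub>R p i x) r = (\<Sum>i\<in>I. c i * fischer k (p i) r)"
  using assms
proof (induction I rule: infinite_finite_induct)
  case (insert i I)
  then have "polynomial_function (\<lambda>x. \<Sum>i\<in>I. c i *\<^sub>R p i x)"
    by (intro polynomial_function_sum polynomial_function_cmul) auto
  with insert show ?case
    by (simp add: fischer_add_left fischer_scaleR_left polynomial_function_cmul)
qed (use fischer_scaleR_left[of "\<lambda>x. 0" k 0 r] in simp_all)

lemma fischer_nonneg: "fischer k p p \<ge> 0"
  by (induction k arbitrary: p) (auto intro: sum_nonneg)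

text \<open>Induction on the degree: a vanishing sum of nonnegative terms makes every partial
  derivative zero, and Euler's identity recovers \<open>p\<close> from its derivatives, since
  \<open>Suc k\<close> is nonzero. In degree \<open>0\<close>, \<open>0 ^ 0 = 1\<close> makes
  \<open>p\<close> constant.\<close>

lemma fischer_definite:
  assumes "p \<in> homogeneous_polys k" "fischer k p p = 0"
  shows "p = (\<lambda>x. 0)"
  using assms
proof (induction k arbitrary: p)
  case 0
  then have "p (0 *\<^sub>R x) = p x" for x
    using homogeneous_polysD(2)[of p 0 0 x] by simp
  with 0(2) show ?case by auto
next
  case (Suc k)
  have "fischer k (dir_deriv i p) (dir_deriv i p) = 0" if "i \<in> Basis" for i
    using Suc.prems(2) that by (simp add: sum_nonneg_eq_0_iff fischer_nonneg)
  then have "dir_deriv i p = (\<lambda>x. 0)" if "i \<in> Basis" for i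
    using Suc.IH homogeneous_dir_deriv[OF Suc.prems(1)] that by blast
  then have "dir_deriv x p x = 0" for x
    by (simp add: dir_deriv_sum_basis[OF homogeneous_polysD(1)[OF Suc.prems(1)], of x])
  then have "real (Suc k) *\<^sub>R p x = 0" for x
    using Euler_homogeneous[OF Suc.prems(1)] by metis
  then show ?case
    by (simp add: fun_eq_iff del: of_nat_Suc)
qed

lemma fischer_linear_adjoint:
  assumes "polynomial_function p" "polynomial_function q"
    and "bounded_linear h" "bounded_linear h'" "\<And>x y. h x \<bullet> y = x \<bullet> h' y"
  shows "fischer k (\<lambda>x. h (p x)) q = fischer k p (\<lambda>x. h' (q x))"
  using assms(1,2)
  by (induction k arbitrary: p q)
    (simp_all add: assms(3-5) dir_deriv_compose_linear polynomial_dir_deriv)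

section \<open>Adjointness of derivatives along linear vector fields\<close>

definition lie_deriv :: "('a::real_normed_vector \<Rightarrow> 'a) \<Rightarrow> ('a \<Rightarrow> 'b::real_normed_vector) \<Rightarrow> 'a \<Rightarrow> 'b"
  where "lie_deriv h p x = dir_deriv (h x) p x"

lemma lie_deriv_sum_basis:
  fixes p :: "'a::euclidean_space \<Rightarrow> 'b::euclidean_space"
  assumes "polynomial_function p"
  shows "lie_deriv h p = (\<lambda>x. \<Sum>i\<in>Basis. (h x \<bullet> i) *\<^sub>R dir_deriv i p x)"
  unfolding lie_deriv_def by (rule ext) (rule dir_deriv_sum_basis[OF assms])

lemma polynomial_lie_deriv:
  fixes p :: "'a::euclidean_space \<Rightarrow> 'b::euclidean_space"
  assumes "polynomial_function p" "bounded_linear h"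
  shows "polynomial_function (lie_deriv h p)"
  unfolding lie_deriv_sum_basis[OF assms(1)]
  by (intro polynomial_function_sum polynomial_function_mult polynomial_function_inner
      polynomial_dir_deriv assms polynomial_function_bounded_linear) simp

text \<open>The coefficient \<open>h x\<close> depends on the point too, and its derivative produces
  the extra term with direction \<open>h v\<close>. The other term is reordered by symmetry of
  second derivatives.\<close>

lemma dir_deriv_lie_deriv:
  fixes p :: "'a::euclidean_space \<Rightarrow> 'b::euclidean_space"
  assumes p: "polynomial_function p" and h: "bounded_linear h"
  shows "dir_deriv v (lie_deriv h p) = (\<lambda>x. lie_deriv h (dir_deriv v p) x + dir_deriv (h v) p x)"
proof
  fix x
  have "(lie_deriv h p has_derivative (\<lambda>v. \<Sum>i\<in>Basis.
      (h x \<bullet> i) *\<^sub>R dir_deriv v (dir_deriv i p) x + (h v \<bullet> i) *\<^sub>R dir_deriv i p x)) (at x)"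
    unfolding lie_deriv_sum_basis[OF p]
    by (intro has_derivative_sum has_derivative_scaleR has_derivative_inner_left
        bounded_linear_imp_has_derivative h polynomial_has_derivative polynomial_dir_deriv p)
  from dir_deriv_eq[OF this, of v]
  show "dir_deriv v (lie_deriv h p) x = lie_deriv h (dir_deriv v p) x + dir_deriv (h v) p x"
    by (simp add: sum.distrib dir_deriv_commute[OF p, of v] dir_deriv_sum_basis[OF p, of "h v"]
        lie_deriv_sum_basis[OF polynomial_dir_deriv[OF p]])
qed

text \<open>Induction on \<open>k\<close>: each derivative of \<open>lie_deriv h p\<close> leaves a
  commutator term, and these terms are matched by transposing the matrix of
  \<open>h\<close>.\<close>

lemma fischer_lie_deriv_adjoint:
  assumes "polynomial_function p" "polynomial_function q"
    and h: "bounded_linear h" and h': "bounded_linear h'" and adj: "\<And>x y. h x \<bullet> y = x \<bullet> h' y"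
  shows "fischer k (lie_deriv h p) q = fischer k p (lie_deriv h' q)"
  using assms(1,2)
proof (induction k arbitrary: p q)
  case 0
  \<comment> \<open>A linear vector field vanishes at the origin, where \<open>fischer 0\<close>
    evaluates.\<close>
  have "lie_deriv g r 0 = 0" if "polynomial_function r" "bounded_linear g"
    for g and r :: "'a \<Rightarrow> 'b"
    using dir_deriv_sum_basis[OF that(1), of 0 0] linear_0[OF bounded_linear.linear[OF that(2)]]
    by (simp add: lie_deriv_def)
  with 0 h h' show ?case by simp
next
  case (Suc k)
  note p = Suc.prems(1) and q = Suc.prems(2)
  \<comment> \<open>Applied with \<open>v = g i\<close>, this exposes the matrix entries of
    \<open>g\<close>.\<close>
  have expand: "fischer k (dir_deriv v r) s = (\<Sum>j\<in>Basis. (v \<bullet> j) * fischer k (dir_deriv j r) s)"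
    if "polynomial_function r" for v and r s :: "'a \<Rightarrow> 'b"
    using fischer_sum_left[of Basis "\<lambda>j. dir_deriv j r" k "\<lambda>j. v \<bullet> j" s]
      dir_deriv_sum_basis[OF that, of v] polynomial_dir_deriv[OF that]
    by (metis (no_types, lifting) ext)
  have step: "fischer (Suc k) (lie_deriv g r) s =
      (\<Sum>i\<in>Basis. fischer k (lie_deriv g (dir_deriv i r)) (dir_deriv i s)) +
      (\<Sum>i\<in>Basis. \<Sum>j\<in>Basis. (g i \<bullet> j) * fischer k (dir_deriv j r) (dir_deriv i s))"
    if "polynomial_function r" "bounded_linear g" for g and r s :: "'a \<Rightarrow> 'b"
    using that by (simp add: dir_deriv_lie_deriv fischer_add_left polynomial_dir_deriv
        polynomial_lie_deriv sum.distrib expand[OF that(1), of "g _"])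
  \<comment> \<open>Exchanging \<open>i\<close> and \<open>j\<close> transposes the matrix; the
    transposed entries are those of \<open>h'\<close>.\<close>
  have "(\<Sum>i\<in>Basis. \<Sum>j\<in>Basis. (h i \<bullet> j) * fischer k (dir_deriv j p) (dir_deriv i q)) =
      (\<Sum>i\<in>Basis. \<Sum>j\<in>Basis. (h' i \<bullet> j) * fischer k (dir_deriv j q) (dir_deriv i p))"
    by (subst sum.swap) (simp add: adj inner_commute[of _ "h' _"] fischer_commute[of k "dir_deriv _ p"])
  moreover have "(\<Sum>i\<in>Basis. fischer k (lie_deriv h (dir_deriv i p)) (dir_deriv i q)) =
      (\<Sum>i\<in>Basis. fischer k (lie_deriv h' (dir_deriv i q)) (dir_deriv i p))"
    by (simp add: Suc.IH polynomial_dir_deriv p q fischer_commute[of k "dir_deriv _ p"])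
  ultimately have "fischer (Suc k) (lie_deriv h p) q = fischer (Suc k) (lie_deriv h' q) p"
    unfolding step[OF p h] step[OF q h'] by simp
  then show ?case
    by (simp only: fischer_commute[of _ "lie_deriv h' q"])
qed

section \<open>Finite generation of the homogeneous mappings\<close>

lemma map_subspace_homogeneous_polys: "map_subspace (homogeneous_polys k)"
  by (auto simp: map_subspace_def homogeneous_polys_def scaleR_add_right
      polynomial_function_add polynomial_function_cmul)

text \<open>By Euler's identity, \<open>p\<close> of degree \<open>Suc k\<close> is a combination of
  coordinates times its partial derivatives, which have degree \<open>k\<close>; so coordinates
  times generators of degree \<open>k\<close> suffice.\<close>

lemma homogeneous_polys_generators:
  "\<exists>B :: ('v::euclidean_space \<Rightarrow> 'v) set. finite B \<and> map_subspace hull B = homogeneous_polys k"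
proof (induction k)
  case 0
  let ?B = "(\<lambda>b x. b) ` (Basis :: 'v set)"
  have "map_subspace hull ?B \<subseteq> homogeneous_polys 0"
    by (rule hull_minimal[where S = map_subspace, OF _ map_subspace_homogeneous_polys])
      (auto simp: homogeneous_polys_def)
  moreover have "p \<in> map_subspace hull ?B" if "p \<in> homogeneous_polys 0" for p
  proof -
    have "p (0 *\<^sub>R x) = p x" for x
      using homogeneous_polysD(2)[OF that, of 0 x] by simp
    then have "p x = p 0" for x by (metis scaleR_zero_left)
    then have "p = (\<lambda>x. \<Sum>b\<in>Basis. (p 0 \<bullet> b) *\<^sub>R b)"
      by (simp add: fun_eq_iff euclidean_representation)
    also have "\<dots> \<in> map_subspace hull ?B"
      by (intro map_subspace_sum map_subspaceD(3) map_subspace_hull) (auto intro: hull_inc)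
    finally show ?thesis .
  qed
  ultimately show ?case
    by (intro exI[of _ ?B]) auto
next
  case (Suc k)
  then obtain B :: "('v \<Rightarrow> 'v) set"
    where B: "finite B" "map_subspace hull B = homogeneous_polys k" by blast
  let ?C = "(\<lambda>(i, m) x. (x \<bullet> i) *\<^sub>R m x) ` (Basis \<times> B)"
  have "B \<subseteq> homogeneous_polys k"
    using hull_subset[of B map_subspace] by (simp add: B(2))
  then have "map_subspace hull ?C \<subseteq> homogeneous_polys (Suc k)"
    by (intro hull_minimal[where S = map_subspace, OF _ map_subspace_homogeneous_polys])
      (fastforce simp: homogeneous_polys_def intro!: polynomial_function_mult polynomial_function_inner)
  moreover have "p \<in> map_subspace hull ?C" if p: "p \<in> homogeneous_polys (Suc k)" for p
  proof -
    \<comment> \<open>Multiplication by a fixed coordinate is linear, so membership only has to be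
      checked for \<open>m\<close> in \<open>B\<close>.\<close>
    have mult: "(\<lambda>x. (x \<bullet> i) *\<^sub>R m x) \<in> map_subspace hull ?C"
      if "i \<in> Basis" "m \<in> homogeneous_polys k" for i m
    proof -
      have "map_subspace hull B \<subseteq> {m. (\<lambda>x. (x \<bullet> i) *\<^sub>R m x) \<in> map_subspace hull ?C}"
      proof (rule hull_minimal)
        show "map_subspace {m. (\<lambda>x. (x \<bullet> i) *\<^sub>R m x) \<in> map_subspace hull ?C}"
          using map_subspaceD[OF map_subspace_hull[of ?C]]
          by (auto simp: map_subspace_def scaleR_add_right scaleR_left_commute[of "_ \<bullet> _"]
              simp del: scaleR_scaleR)
        show "B \<subseteq> {m. (\<lambda>x. (x \<bullet> i) *\<^sub>R m x) \<in> map_subspace hull ?C}"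
          using that(1) by (fastforce intro: hull_inc)
      qed
      with that(2) B(2) show ?thesis by auto
    qed
    have "p = (\<lambda>x. (1 / real (Suc k)) *\<^sub>R (\<Sum>i\<in>Basis. (x \<bullet> i) *\<^sub>R dir_deriv i p x))"
    proof
      fix x
      have "(1 / real (Suc k)) *\<^sub>R dir_deriv x p x = p x"
        unfolding Euler_homogeneous[OF p] by (simp del: of_nat_Suc)
      then show "p x = (1 / real (Suc k)) *\<^sub>R (\<Sum>i\<in>Basis. (x \<bullet> i) *\<^sub>R dir_deriv i p x)"
        by (simp add: dir_deriv_sum_basis[OF homogeneous_polysD(1)[OF p], of x])
    qed
    also have "\<dots> \<in> map_subspace hull ?C"
      by (intro map_subspace_sum map_subspaceD(3) map_subspace_hull mult homogeneous_dir_deriv p)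
    finally show ?thesis .
  qed
  ultimately show ?case
    using B(1) by (intro exI[of _ ?C]) auto
qed

section \<open>The one-parameter group\<close>

definition blinfun_power :: "('v::banach \<Rightarrow>\<^sub>L 'v) \<Rightarrow> nat \<Rightarrow> ('v \<Rightarrow>\<^sub>L 'v)"
  where "blinfun_power A n = ((o\<^sub>L) A ^^ n) id_blinfun"

lemma blinfun_power_0 [simp]: "blinfun_power A 0 = id_blinfun"
  by (simp add: blinfun_power_def)

lemma blinfun_power_Suc [simp]: "blinfun_power A (Suc n) = A o\<^sub>L blinfun_power A n"
  by (simp add: blinfun_power_def)

lemma blinfun_power_apply_commute: "blinfun_power A n (A x) = A (blinfun_power A n x)"
  by (induction n) auto

lemma blinfun_power_scaleR: "blinfun_power (s *\<^sub>R A) n = s ^ n *\<^sub>R blinfun_power A n"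
  by (induction n) (auto intro!: blinfun_eqI simp: blinfun.bilinear_simps)

lemma norm_blinfun_power: "norm (blinfun_power A n) \<le> norm A ^ n"
proof (induction n)
  case (Suc n)
  have "norm (blinfun_power A (Suc n)) \<le> norm A * norm (blinfun_power A n)"
    by (simp add: norm_blinfun_compose)
  also have "\<dots> \<le> norm A * norm A ^ n"
    using Suc by (intro mult_left_mono) auto
  finally show ?case by simp
qed (simp add: norm_blinfun_id_le)

lemma blinfun_exp_sums: "(\<lambda>n. blinfun_power A n /\<^sub>R fact n) sums blinfun_exp A"
proof -
  have "summable (\<lambda>n. blinfun_power A n /\<^sub>R fact n)"
  proof (rule summable_comparison_test'[OF summable_exp[of "norm A"], where N = 0])
    show "norm (blinfun_power A n /\<^sub>R fact n) \<le> inverse (fact n) * norm A ^ n" for n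
      using norm_blinfun_power[of A n] by (simp add: mult_left_mono)
  qed
  then show ?thesis
    unfolding blinfun_exp_def blinfun_power_def[symmetric] by (rule summable_sums)
qed

lemma blinfun_exp_apply_sums: "(\<lambda>n. blinfun_power A n x /\<^sub>R fact n) sums blinfun_exp A x"
  using bounded_linear.sums[OF blinfun.bounded_linear_left blinfun_exp_sums, of A x]
  by (simp add: blinfun.scaleR_left)

lemma blinfun_exp_commute: "blinfun_exp A (A x) = A (blinfun_exp A x)"
proof -
  have "(\<lambda>n. A (blinfun_power A n x /\<^sub>R fact n)) sums A (blinfun_exp A x)"
    by (rule bounded_linear.sums[OF blinfun.bounded_linear_right blinfun_exp_apply_sums])
  with blinfun_exp_apply_sums[of A "A x"] show ?thesis
    by (simp add: blinfun.scaleR_right blinfun_power_apply_commute sums_unique2)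
qed

text \<open>Each matrix coefficient of the flow is a scalar power series in \<open>s\<close>, which
  allows termwise differentiation.\<close>

lemma blinfun_exp_scaleR_inner_sums:
  fixes x :: "'v::euclidean_space"
  shows "(\<lambda>n. (blinfun_power A n x \<bullet> b / fact n) * s ^ n) sums (blinfun_exp (s *\<^sub>R A) x \<bullet> b)"
  using bounded_linear.sums[OF bounded_linear_inner_left blinfun_exp_apply_sums, of "s *\<^sub>R A" x b]
  by (simp add: blinfun_power_scaleR blinfun.scaleR_left divide_inverse mult_ac)

lemma blinfun_exp_zero [simp]: "blinfun_exp 0 = id_blinfun"
proof -
  have "(\<lambda>n. blinfun_power (0 :: 'a \<Rightarrow>\<^sub>L 'a) n /\<^sub>R fact n) = (\<lambda>n. if n = 0 then id_blinfun else 0)"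
  proof
    show "blinfun_power (0 :: 'a \<Rightarrow>\<^sub>L 'a) n /\<^sub>R fact n = (if n = 0 then id_blinfun else 0)" for n
      by (cases n) auto
  qed
  then show ?thesis
    using sums_unique2[OF blinfun_exp_sums[of "0 :: 'a \<Rightarrow>\<^sub>L 'a"]] sums_single[of 0 "\<lambda>_. id_blinfun"]
    by simp
qed

lemma blinfun_exp_scaleR_commute: "blinfun_exp (s *\<^sub>R A) (A x) = A (blinfun_exp (s *\<^sub>R A) x)"
proof (cases "s = 0")
  case False
  have "s *\<^sub>R blinfun_exp (s *\<^sub>R A) (A x) = s *\<^sub>R A (blinfun_exp (s *\<^sub>R A) x)"
    using blinfun_exp_commute[of "s *\<^sub>R A" x] by (simp add: blinfun.bilinear_simps)
  with False show ?thesis by simp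
qed simp

lemma blinfun_exp_has_vector_derivative:
  fixes x :: "'v::euclidean_space"
  shows "((\<lambda>s. blinfun_exp (s *\<^sub>R A) x) has_vector_derivative blinfun_exp (s *\<^sub>R A) (A x)) (at s)"
  unfolding has_vector_derivative_def
proof (subst has_derivative_componentwise_within, rule ballI)
  fix b :: 'v
  let ?c = "\<lambda>n. blinfun_power A n x \<bullet> b / fact n"
  have "((\<lambda>s. \<Sum>n. ?c n * s ^ n) has_field_derivative (\<Sum>n. diffs ?c n * s ^ n)) (at s)"
    using blinfun_exp_scaleR_inner_sums[of A x b]
    by (intro termdiffs_strong_converges_everywhere) (rule sums_summable)
  moreover have "(\<lambda>s. \<Sum>n. ?c n * s ^ n) = (\<lambda>s. blinfun_exp (s *\<^sub>R A) x \<bullet> b)"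
    using blinfun_exp_scaleR_inner_sums[of A x b, THEN sums_unique] by simp
  \<comment> \<open>The factor \<open>Suc n\<close> from differentiation cancels against
    \<open>fact (Suc n)\<close>, and the additional power of \<open>A\<close> moves onto
    \<open>x\<close>.\<close>
  moreover have "diffs ?c = (\<lambda>n. blinfun_power A n (A x) \<bullet> b / fact n)"
    by (simp add: diffs_def blinfun_power_apply_commute fun_eq_iff del: of_nat_Suc)
  then have "(\<Sum>n. diffs ?c n * s ^ n) = blinfun_exp (s *\<^sub>R A) (A x) \<bullet> b"
    using blinfun_exp_scaleR_inner_sums[of A "A x" b s, THEN sums_unique] by simp
  ultimately show "((\<lambda>s. blinfun_exp (s *\<^sub>R A) x \<bullet> b) has_derivative
      (\<lambda>t. (t *\<^sub>R blinfun_exp (s *\<^sub>R A) (A x)) \<bullet> b)) (at s)"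
    by (simp add: has_field_derivative_def mult.commute[of _ "blinfun_exp _ _ \<bullet> _"])
qed

text \<open>Product rule for a moving vector; expanding \<open>y t\<close> in the basis reduces it
  to fixed vectors with scalar coefficients.\<close>

lemma blinfun_exp_curve_has_vector_derivative:
  fixes y :: "real \<Rightarrow> 'v::euclidean_space"
  assumes "(y has_vector_derivative y') (at s)"
  shows "((\<lambda>t. blinfun_exp (t *\<^sub>R A) (y t)) has_vector_derivative
    blinfun_exp (s *\<^sub>R A) (y' + A (y s))) (at s)"
proof -
  have sum_eq: "F z = (\<Sum>b\<in>Basis. (z \<bullet> b) *\<^sub>R F b)" for F :: "'v \<Rightarrow>\<^sub>L 'v" and z
    by (subst euclidean_representation[symmetric, of z])
      (simp only: blinfun.sum_right blinfun.scaleR_right)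
  have y: "((\<lambda>t. y t \<bullet> b) has_field_derivative y' \<bullet> b) (at s)" for b
    using bounded_linear.has_vector_derivative[OF bounded_linear_inner_left assms]
    by (simp add: has_real_derivative_iff_has_vector_derivative)
  have "((\<lambda>t. \<Sum>b\<in>Basis. (y t \<bullet> b) *\<^sub>R blinfun_exp (t *\<^sub>R A) b) has_vector_derivative
      (\<Sum>b\<in>Basis. (y s \<bullet> b) *\<^sub>R blinfun_exp (s *\<^sub>R A) (A b) + (y' \<bullet> b) *\<^sub>R blinfun_exp (s *\<^sub>R A) b)) (at s)"
    by (intro has_vector_derivative_sum has_vector_derivative_scaleR y blinfun_exp_has_vector_derivative)
  moreover have "(\<Sum>b\<in>Basis. (y s \<bullet> b) *\<^sub>R blinfun_exp (s *\<^sub>R A) (A b)) = blinfun_exp (s *\<^sub>R A) (A (y s))"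
    using sum_eq[of "blinfun_exp (s *\<^sub>R A) o\<^sub>L A" "y s"] by simp
  ultimately show ?thesis
    by (simp add: sum.distrib sum_eq[symmetric] blinfun.add_right add.commute)
qed

lemma Ad_eq: "Ad L p = (\<lambda>x. lie_deriv L p x - L (p x))"
  by (simp add: Ad_def lie_deriv_def dir_deriv_def)

text \<open>The left side, as a function of \<open>s\<close>, has as derivative the inverse flow
  applied to the value of \<open>Ad M p\<close> along the flow, which is zero; at
  \<open>s = 0\<close> it equals \<open>p x\<close>.\<close>

lemma blinfun_exp_conjugation_constant:
  assumes p: "polynomial_function p" and Ad: "Ad M p = (\<lambda>x. 0)"
  shows "blinfun_exp (s *\<^sub>R - M) (p (blinfun_exp (s *\<^sub>R M) x)) = p x"
proof -
  let ?f = "\<lambda>s. blinfun_exp (s *\<^sub>R - M) (p (blinfun_exp (s *\<^sub>R M) x))"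
  have "(?f has_vector_derivative 0) (at t)" for t
  proof -
    let ?y = "blinfun_exp (t *\<^sub>R M) x"
    have deriv: "((p \<circ> (\<lambda>s. blinfun_exp (s *\<^sub>R M) x)) has_vector_derivative dir_deriv (M ?y) p ?y) (at t)"
      using vector_derivative_diff_chain_within[OF blinfun_exp_has_vector_derivative[of M x t]
          has_derivative_at_withinI[OF polynomial_has_derivative[OF p]]]
      by (simp only: blinfun_exp_scaleR_commute)
    have zero: "dir_deriv (M ?y) p ?y + (- M) (p ?y) = 0"
      using fun_cong[OF Ad, of ?y] by (simp add: Ad_eq lie_deriv_def blinfun.minus_left)
    from blinfun_exp_curve_has_vector_derivative[OF deriv, of "- M", unfolded o_def zero]
    show ?thesis by simp
  qed
  then obtain c where c: "?f t = c" for t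
    using has_vector_derivative_zero_constant[of UNIV ?f] by auto
  from c[of s] c[of 0] show ?thesis by simp
qed

text \<open>The identity mapping lies in the kernel of \<open>Ad M\<close>, so its conjugate by the
  flow is constant.\<close>

lemma blinfun_exp_minus:
  fixes x :: "'v::euclidean_space"
  shows "blinfun_exp (s *\<^sub>R - M) (blinfun_exp (s *\<^sub>R M) x) = x"
proof -
  have "Ad M (\<lambda>x. x) = (\<lambda>x. 0)"
    by (simp add: Ad_def frechet_derivative_ident)
  from blinfun_exp_conjugation_constant[OF polynomial_function_id this] show ?thesis
    by simp
qed

lemma blinfun_exp_minus':
  fixes x :: "'v::euclidean_space"
  shows "blinfun_exp (s *\<^sub>R M) (blinfun_exp (s *\<^sub>R - M) x) = x"
  using blinfun_exp_minus[of s "- M" x] by simp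

lemma blinfun_exp_in_GL: "blinfun_exp (s *\<^sub>R M) \<in> GL"
  unfolding GL_def using blinfun_exp_minus[of s M] blinfun_exp_minus'[of s M]
  by (auto intro!: o_bij[of "blinfun_exp (s *\<^sub>R - M)"])

text \<open>One direction undoes the constant conjugation; the other differentiates the commutation
  relation at \<open>s = 0\<close>.\<close>

lemma Ad_zero_iff_commutes_exp:
  assumes p: "polynomial_function p"
  shows "Ad M p = (\<lambda>x. 0) \<longleftrightarrow> (\<forall>s x. p (blinfun_exp (s *\<^sub>R M) x) = blinfun_exp (s *\<^sub>R M) (p x))"
proof
  assume "Ad M p = (\<lambda>x. 0)"
  then show "\<forall>s x. p (blinfun_exp (s *\<^sub>R M) x) = blinfun_exp (s *\<^sub>R M) (p x)"
    using blinfun_exp_conjugation_constant[OF p] blinfun_exp_minus' by metis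
next
  assume *: "\<forall>s x. p (blinfun_exp (s *\<^sub>R M) x) = blinfun_exp (s *\<^sub>R M) (p x)"
  show "Ad M p = (\<lambda>x. 0)"
  proof
    fix x
    have "((p \<circ> (\<lambda>s. blinfun_exp (s *\<^sub>R M) x)) has_vector_derivative dir_deriv (M x) p x) (at 0)"
      using vector_derivative_diff_chain_within[OF blinfun_exp_has_vector_derivative[of M x 0]
          has_derivative_at_withinI[OF polynomial_has_derivative[OF p]]]
      by simp
    moreover have "((p \<circ> (\<lambda>s. blinfun_exp (s *\<^sub>R M) x)) has_vector_derivative M (p x)) (at 0)"
      using blinfun_exp_has_vector_derivative[of M "p x" 0] * by (simp add: o_def)
    ultimately have "dir_deriv (M x) p x = M (p x)"
      by (rule vector_derivative_unique_at)
    then show "Ad M p x = 0"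
      by (simp add: Ad_eq lie_deriv_def)
  qed
qed

text \<open>For polynomial \<open>p\<close>, commuting with \<open>A\<close> is a closed condition
  on \<open>A\<close>, so it passes from the flow to its closure; the converse holds since the
  carrier contains the flow.\<close>

lemma commutes_S_group_iff:
  assumes p: "polynomial_function p"
  shows "(\<forall>A\<in>carrier (S_group L). \<forall>x. p (A x) = A (p x)) \<longleftrightarrow> Ad (blinfun_adjoint L) p = (\<lambda>x. 0)"
proof -
  let ?E = "range (\<lambda>s. blinfun_exp (s *\<^sub>R blinfun_adjoint L))"
  \<comment> \<open>Closure relative to \<open>GL\<close> is the ambient closure cut down to
    \<open>GL\<close>, because the flow consists of invertible maps.\<close>
  have carrier: "carrier (S_group L) = GL \<inter> closure ?E"
  proof -
    have "GL \<inter> ?E = ?E"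
      using blinfun_exp_in_GL by blast
    then show ?thesis
      by (simp add: S_group_def closure_of_subtopology)
  qed
  have E: "?E \<subseteq> carrier (S_group L)"
    unfolding carrier using blinfun_exp_in_GL closure_subset[of ?E] by blast
  have "closed {A :: 'a \<Rightarrow>\<^sub>L 'a. p (A x) = A (p x)}" for x
  proof (rule closed_Collect_eq)
    have "continuous_on UNIV p"
      using p by (rule continuous_on_polymonial_function)
    then show "continuous_on UNIV (\<lambda>A :: 'a \<Rightarrow>\<^sub>L 'a. p (A x))"
      by (rule continuous_on_compose2) (auto intro!: continuous_intros)
  qed (auto intro!: continuous_intros)
  then have "closed {A :: 'a \<Rightarrow>\<^sub>L 'a. \<forall>x. p (A x) = A (p x)}"
    by (rule closed_Collect_all)
  then have "closure ?E \<subseteq> {A. \<forall>x. p (blinfun_apply A x) = A (p x)}" if "?E \<subseteq> {A. \<forall>x. p (blinfun_apply A x) = A (p x)}"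
    using that by (rule closure_minimal[rotated])
  then have "(\<forall>A\<in>carrier (S_group L). \<forall>x. p (A x) = A (p x)) \<longleftrightarrow> (\<forall>A\<in>?E. \<forall>x. p (A x) = A (p x))"
    using E unfolding carrier by blast
  then show ?thesis
    by (simp add: Ad_zero_iff_commutes_exp[OF p])
qed

section \<open>The homological operator\<close>

lemma inner_blinfun_adjoint: "blinfun_apply L x \<bullet> y = x \<bullet> blinfun_adjoint L y"
proof -
  have lin: "linear (blinfun_apply L)"
    by (rule bounded_linear.linear[OF blinfun.bounded_linear_right])
  then have "bounded_linear (adjoint (blinfun_apply L))"
    by (simp add: adjoint_linear linear_conv_bounded_linear[symmetric])
  then show ?thesis
    by (simp add: blinfun_adjoint_def bounded_linear_Blinfun_apply adjoint_works[OF lin])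
qed

lemma fischer_diff_left:
  assumes "polynomial_function p" "polynomial_function q"
  shows "fischer k (\<lambda>x. p x - q x) r = fischer k p r - fischer k q r"
  using fischer_add_left[OF assms(1) polynomial_function_cmul[OF assms(2), of "-1"], of k r]
    fischer_scaleR_left[OF assms(2), of k "-1" r] by simp

lemma polynomial_bounded_linear_compose:
  assumes p: "polynomial_function p" and h: "bounded_linear h"
  shows "polynomial_function (\<lambda>x. h (p x))"
  unfolding polynomial_function_def
proof (intro allI impI)
  fix f :: "'c \<Rightarrow> real" assume "bounded_linear f"
  then have "bounded_linear (\<lambda>y. f (h y))"
    using h by (rule bounded_linear_compose)
  then show "real_polynomial_function (f \<circ> (\<lambda>x. h (p x)))"
    using p by (auto simp: polynomial_function_def o_def)
qed

lemma
  fixes p :: "'v::euclidean_space \<Rightarrow> 'v"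
  assumes p: "polynomial_function p"
  shows polynomial_lie_deriv_blinfun: "polynomial_function (lie_deriv (blinfun_apply L) p)"
    and polynomial_blinfun_compose: "polynomial_function (\<lambda>x. blinfun_apply L (p x))"
  using polynomial_lie_deriv[OF p blinfun.bounded_linear_right]
    polynomial_bounded_linear_compose[OF p blinfun.bounded_linear_right] by auto

lemma Ad_homogeneous:
  assumes p: "p \<in> homogeneous_polys k"
  shows "Ad L p \<in> homogeneous_polys k"
proof -
  note poly = homogeneous_polysD(1)[OF p]
  have "polynomial_function (Ad L p)"
    unfolding Ad_eq by (intro polynomial_function_diff polynomial_lie_deriv_blinfun
        polynomial_blinfun_compose poly)
  moreover have "Ad L p (c *\<^sub>R x) = c ^ k *\<^sub>R Ad L p x" for c x
    using homogeneous_dir_deriv_scaleR[OF p, of c "L x" x]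
    by (simp add: Ad_eq lie_deriv_def blinfun.scaleR_right homogeneous_polysD(2)[OF p] scaleR_diff_right)
  ultimately show ?thesis
    by (simp add: homogeneous_polys_def)
qed

lemma Ad_add:
  assumes "polynomial_function p" "polynomial_function q"
  shows "Ad L (\<lambda>x. p x + q x) = (\<lambda>x. Ad L p x + Ad L q x)"
  by (simp add: Ad_eq lie_deriv_def dir_deriv_add[OF assms] blinfun.add_right fun_eq_iff)

lemma Ad_scaleR:
  assumes "polynomial_function p"
  shows "Ad L (\<lambda>x. c *\<^sub>R p x) = (\<lambda>x. c *\<^sub>R Ad L p x)"
  by (simp add: Ad_eq lie_deriv_def dir_deriv_scaleR[OF assms] blinfun.scaleR_right scaleR_diff_right)

lemma Ad_diff:
  assumes "polynomial_function p" "polynomial_function q"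
  shows "Ad L (\<lambda>x. p x - q x) = (\<lambda>x. Ad L p x - Ad L q x)"
  using Ad_add[OF assms(1) polynomial_function_cmul[OF assms(2), of "-1"], of L]
    Ad_scaleR[OF assms(2), of L "-1"] by simp

lemma fischer_Ad_adjoint:
  assumes p: "polynomial_function p" and q: "polynomial_function q"
    and adj: "\<And>x y. blinfun_apply L x \<bullet> y = x \<bullet> blinfun_apply M y"
  shows "fischer k (Ad L p) q = fischer k p (Ad M q)"
proof -
  have "fischer k (Ad L p) q = fischer k (lie_deriv L p) q - fischer k (\<lambda>x. L (p x)) q"
    unfolding Ad_eq by (rule fischer_diff_left[OF polynomial_lie_deriv_blinfun[OF p]
          polynomial_blinfun_compose[OF p]])
  also have "\<dots> = fischer k p (lie_deriv M q) - fischer k p (\<lambda>x. M (q x))"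
    using fischer_lie_deriv_adjoint[OF p q _ _ adj] fischer_linear_adjoint[OF p q _ _ adj]
    by (simp add: blinfun.bounded_linear_right)
  also have "\<dots> = fischer k p (Ad M q)"
    unfolding Ad_eq fischer_commute[of k p]
    by (rule fischer_diff_left[symmetric, OF polynomial_lie_deriv_blinfun[OF q]
          polynomial_blinfun_compose[OF q]])
  finally show ?thesis .
qed

text \<open>\<open>M\<close> is kept abstract so that the roles of \<open>L\<close> and its adjoint
  can be exchanged.\<close>

lemma adjoint_maps_Ad:
  assumes "\<And>x y. blinfun_apply L x \<bullet> y = x \<bullet> blinfun_apply M y"
  obtains B where "adjoint_maps (homogeneous_polys k) (fischer k) (Ad L) (Ad M) B"
proof -
  obtain B :: "('a \<Rightarrow> 'a) set" where "finite B" "map_subspace hull B = homogeneous_polys k"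
    using homogeneous_polys_generators by blast
  then have "adjoint_maps (homogeneous_polys k) (fischer k) (Ad L) (Ad M) B"
  proof unfold_locales
    note poly = homogeneous_polysD(1)
    let ?H = "homogeneous_polys k :: ('a \<Rightarrow> 'a) set"
    show "map_subspace ?H"
      by (rule map_subspace_homogeneous_polys)
    show "fischer k (\<lambda>x. p x + q x) r = fischer k p r + fischer k q r" if "p \<in> ?H" "q \<in> ?H" for p q r
      by (rule fischer_add_left[OF that[THEN poly]])
    show "fischer k (\<lambda>x. c *\<^sub>R p x) r = c * fischer k p r" if "p \<in> ?H" for c p r
      by (rule fischer_scaleR_left[OF poly[OF that]])
    show "fischer k p q = fischer k q p" for p q :: "'a \<Rightarrow> 'a"
      by (rule fischer_commute)
    show "p = (\<lambda>x. 0)" if "p \<in> ?H" "fischer k p p = 0" for p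
      using that by (rule fischer_definite)
    show "Ad L p \<in> ?H" "Ad M p \<in> ?H" if "p \<in> ?H" for p
      using that by (rule Ad_homogeneous)+
    show "Ad L (\<lambda>x. p x + q x) = (\<lambda>x. Ad L p x + Ad L q x)" if "p \<in> ?H" "q \<in> ?H" for p q
      by (rule Ad_add[OF that[THEN poly]])
    show "Ad L (\<lambda>x. c *\<^sub>R p x) = (\<lambda>x. c *\<^sub>R Ad L p x)" if "p \<in> ?H" for c p
      by (rule Ad_scaleR[OF poly[OF that]])
    show "fischer k (Ad L p) q = fischer k p (Ad M q)" if "p \<in> ?H" "q \<in> ?H" for p q
      by (rule fischer_Ad_adjoint[OF that[THEN poly] assms])
  qed
  then show thesis by (rule that)
qed

section \<open>Conjugation symmetry and the covariant splitting\<close>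

lemma homogeneous_conjugate:
  assumes p: "p \<in> homogeneous_polys k" and g: "bounded_linear g" and h: "bounded_linear h"
  shows "(\<lambda>x. h (p (g x))) \<in> homogeneous_polys k"
proof -
  have "polynomial_function (p \<circ> g)"
    by (intro polynomial_function_compose polynomial_function_bounded_linear g homogeneous_polysD(1)[OF p])
  from polynomial_bounded_linear_compose[OF this h]
  have "polynomial_function (\<lambda>x. h (p (g x)))"
    by simp
  then show ?thesis
    by (simp add: homogeneous_polys_def homogeneous_polysD(2)[OF p]
        linear_cmul[OF bounded_linear.linear[OF g]] linear_cmul[OF bounded_linear.linear[OF h]])
qed

text \<open>Each term of \<open>Ad\<close> yields one factor \<open>s\<close>: the derivative term
  when \<open>L\<close> passes \<open>g\<close>, the other when \<open>L\<close> passes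
  \<open>h\<close>. The relation \<open>s * s = 1\<close> moves the sign across and transfers the
  commutation rule from \<open>g\<close> to its inverse \<open>h\<close>.\<close>

lemma Ad_conjugate:
  assumes p: "polynomial_function p" and g: "bounded_linear g" and h: "bounded_linear h"
    and inv: "\<And>x. h (g x) = x" "\<And>x. g (h x) = x" and s: "s * s = (1::real)"
    and L: "\<And>x. blinfun_apply L (g x) = s *\<^sub>R g (L x)"
  shows "Ad L (\<lambda>x. h (p (g x))) = (\<lambda>x. s *\<^sub>R h (Ad L p (g x)))"
proof
  fix x
  note lin = linear_cmul[OF bounded_linear.linear[OF g]] linear_cmul[OF bounded_linear.linear[OF h]]
  have gL: "g (L x) = s *\<^sub>R L (g x)"
    by (simp add: L s)
  have "L y = s *\<^sub>R g (L (h y))" for y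
    using L[of "h y"] by (simp add: inv)
  then have "h (L y) = s *\<^sub>R L (h y)" for y
    by (metis inv(1) lin(2))
  then have hL: "L (h y) = s *\<^sub>R h (L y)" for y
    by (simp add: s)
  have "((\<lambda>x. h (p (g x))) has_derivative (\<lambda>v. h (dir_deriv (g v) p (g x)))) (at x)"
    by (intro bounded_linear.has_derivative[OF h] has_derivative_compose[of g g, OF _ polynomial_has_derivative]
        p bounded_linear_imp_has_derivative g)
  from dir_deriv_eq[OF this, of "L x"]
  have "dir_deriv (L x) (\<lambda>x. h (p (g x))) x = h (dir_deriv (s *\<^sub>R L (g x)) p (g x))"
    by (simp add: gL)
  also have "dir_deriv (s *\<^sub>R L (g x)) p (g x) = s *\<^sub>R dir_deriv (L (g x)) p (g x)"
    by (rule linear_cmul[OF has_derivative_linear[OF polynomial_has_derivative[OF p]]])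
  finally show "Ad L (\<lambda>x. h (p (g x))) x = s *\<^sub>R h (Ad L p (g x))"
    by (simp add: Ad_eq lie_deriv_def hL lin scaleR_diff_right
        linear_diff[OF bounded_linear.linear[OF h]])
qed

lemma Ad_kernel_image_trivial:
  assumes "\<And>x y. blinfun_apply L x \<bullet> y = x \<bullet> blinfun_apply M y"
    and "p \<in> homogeneous_polys k" "Ad M (Ad L p) = (\<lambda>x. 0)"
  shows "Ad L p = (\<lambda>x. 0)"
proof -
  obtain B where "adjoint_maps (homogeneous_polys k) (fischer k) (Ad L) (Ad M) B"
    by (rule adjoint_maps_Ad[OF assms(1)])
  from adjoint_maps.kernel_image_trivial[OF this, OF assms(2,3)] show ?thesis .
qed

lemma Ad_kernel_image_sum:
  assumes "\<And>x y. blinfun_apply L x \<bullet> y = x \<bullet> blinfun_apply M y"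
    and "q \<in> homogeneous_polys k"
  obtains a p where "a \<in> homogeneous_polys k" "p \<in> homogeneous_polys k"
    "Ad M a = (\<lambda>x. 0)" "q = (\<lambda>x. a x + Ad L p x)"
proof -
  obtain B where "adjoint_maps (homogeneous_polys k) (fischer k) (Ad L) (Ad M) B"
    by (rule adjoint_maps_Ad[OF assms(1)])
  from adjoint_maps.kernel_image_sum[OF this, OF assms(2)] show thesis
    by (elim bexE conjE) (rule that)
qed

text \<open>Treats each index separately: pulling the splitting of \<open>q\<close> back along
  \<open>g i\<close> gives another splitting, and uniqueness identifies the two. The part
  \<open>a\<close> carries the sign of \<open>q\<close>, while \<open>p\<close> carries none because
  \<open>Ad L\<close> supplies it.\<close>

lemma Ad_covariant_splitting:
  fixes g h :: "'i \<Rightarrow> 'v::euclidean_space \<Rightarrow> 'v" and s :: "'i \<Rightarrow> real"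
  assumes adj: "\<And>x y. blinfun_apply L x \<bullet> y = x \<bullet> blinfun_apply M y"
    and lin: "\<And>i. i \<in> I \<Longrightarrow> bounded_linear (g i)" "\<And>i. i \<in> I \<Longrightarrow> bounded_linear (h i)"
    and inv: "\<And>i x. i \<in> I \<Longrightarrow> h i (g i x) = x" "\<And>i x. i \<in> I \<Longrightarrow> g i (h i x) = x"
    and s: "\<And>i. i \<in> I \<Longrightarrow> s i * s i = 1"
    and L: "\<And>i x. i \<in> I \<Longrightarrow> L (g i x) = s i *\<^sub>R g i (L x)"
    and M: "\<And>i x. i \<in> I \<Longrightarrow> M (g i x) = s i *\<^sub>R g i (M x)"
    and q: "q \<in> homogeneous_polys k" "\<And>i x. i \<in> I \<Longrightarrow> q (g i x) = s i *\<^sub>R g i (q x)"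
  shows "\<exists>a\<in>homogeneous_polys k. \<exists>p\<in>homogeneous_polys k.
    Ad M a = (\<lambda>x. 0) \<and> q = (\<lambda>x. a x + Ad L p x) \<and>
    (\<forall>i\<in>I. \<forall>x. a (g i x) = s i *\<^sub>R g i (a x)) \<and> (\<forall>i\<in>I. \<forall>x. p (g i x) = g i (p x))"
proof -
  have adj': "M x \<bullet> y = x \<bullet> L y" for x y
    using adj[of y x] by (simp add: inner_commute)
  note poly = homogeneous_polysD(1)
  note diff = map_subspace_diff[OF map_subspace_homogeneous_polys]
  note scale = map_subspaceD(3)[OF map_subspace_homogeneous_polys]
  obtain a p0 where a: "a \<in> homogeneous_polys k" "Ad M a = (\<lambda>x. 0)"
    and p0: "p0 \<in> homogeneous_polys k" "q = (\<lambda>x. a x + Ad L p0 x)"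
    by (rule Ad_kernel_image_sum[OF adj q(1)])
  \<comment> \<open>\<open>p0\<close> is determined only up to the kernel of \<open>Ad L\<close>.
    Removing its component \<open>c\<close> there leaves \<open>Ad M r\<close>, which is
    unique.\<close>
  obtain c r where c: "c \<in> homogeneous_polys k" "Ad L c = (\<lambda>x. 0)"
    and r: "r \<in> homogeneous_polys k" "p0 = (\<lambda>x. c x + Ad M r x)"
    by (rule Ad_kernel_image_sum[OF adj' p0(1)])
  define p where "p = Ad M r"
  have p: "p \<in> homogeneous_polys k"
    unfolding p_def by (rule Ad_homogeneous[OF r(1)])
  have q_eq: "q = (\<lambda>x. a x + Ad L p x)"
    unfolding p0(2) r(2) p_def[symmetric] Ad_add[OF poly[OF c(1)] poly[OF p]] c(2) by simp
  have "a (g i x) = s i *\<^sub>R g i (a x) \<and> p (g i x) = g i (p x)" if i: "i \<in> I" for i x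
  proof -
    let ?pull = "\<lambda>u x. h i (u (g i x))"
    note hom = homogeneous_conjugate[OF _ lin[OF i]]
    note hlin = bounded_linear.linear[OF lin(2)[OF i]] and glin = bounded_linear.linear[OF lin(1)[OF i]]
    note AdL = Ad_conjugate[OF poly lin[OF i] inv[OF i] s[OF i] L[OF i]]
    note AdM = Ad_conjugate[OF poly lin[OF i] inv[OF i] s[OF i] M[OF i]]
    \<comment> \<open>The sign is that of \<open>q\<close>, so that the signed pullback fixes
      \<open>q\<close>.\<close>
    let ?a = "\<lambda>x. s i *\<^sub>R ?pull a x"
    have a': "?a \<in> homogeneous_polys k"
      by (intro scale hom a)
    have AdMa': "Ad M ?a = (\<lambda>x. 0)"
      unfolding Ad_scaleR[OF poly[OF hom[OF a(1)]]] AdM[OF a(1)] a(2) by (simp add: linear_0[OF hlin])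
    have "q x = s i *\<^sub>R ?pull q x" for x
      by (simp add: q(2)[OF i] linear_cmul[OF hlin] inv[OF i] s[OF i])
    then have "q x = ?a x + Ad L (?pull p) x" for x
      unfolding AdL[OF p] by (subst (asm) q_eq) (simp add: linear_add[OF hlin] scaleR_add_right)
    \<comment> \<open>The difference of the two splittings of \<open>q\<close>: the left side lies
      in the kernel of \<open>Ad M\<close>, the right side in the image of \<open>Ad L\<close>, so
      both vanish.\<close>
    then have key: "a x - ?a x = Ad L (\<lambda>x. ?pull p x - p x) x" for x
      unfolding Ad_diff[OF poly[OF hom[OF p]] poly[OF p]] using fun_cong[OF q_eq, of x]
      by (simp add: algebra_simps)
    have d: "(\<lambda>x. ?pull p x - p x) \<in> homogeneous_polys k"
      by (intro diff hom p)
    have "Ad M (Ad L (\<lambda>x. ?pull p x - p x)) = Ad M (\<lambda>x. a x - ?a x)"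
      by (simp only: key)
    also have "\<dots> = (\<lambda>x. 0)"
      unfolding Ad_diff[OF poly[OF a(1)] poly[OF a']] a(2) AdMa' by simp
    finally have zero: "Ad L (\<lambda>x. ?pull p x - p x) = (\<lambda>x. 0)"
      by (rule Ad_kernel_image_trivial[OF adj d])
    \<comment> \<open>The sign in \<open>?r\<close> cancels the one from \<open>AdM\<close>, so the
      difference of \<open>?pull p\<close> and \<open>p\<close> lies in the image of
      \<open>Ad M\<close>; it also lies in the kernel of \<open>Ad L\<close> and is therefore
      zero.\<close>
    let ?r = "\<lambda>x. s i *\<^sub>R ?pull r x - r x"
    have "Ad M ?r = (\<lambda>x. ?pull p x - p x)"
      unfolding Ad_diff[OF poly[OF scale[OF hom[OF r(1)]]] poly[OF r(1)]]
        Ad_scaleR[OF poly[OF hom[OF r(1)]]] AdM[OF r(1)] p_def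
      by (simp add: s[OF i])
    moreover have "?r \<in> homogeneous_polys k"
      by (intro diff scale hom r)
    ultimately have "(\<lambda>x. ?pull p x - p x) = (\<lambda>x. 0)"
      using Ad_kernel_image_trivial[OF adj', of ?r k] zero by simp
    then have "h i (p (g i x)) = p x" for x
      by (metis eq_iff_diff_eq_0)
    moreover have "a x = s i *\<^sub>R h i (a (g i x))"
      using key[of x] by (simp add: zero)
    ultimately show ?thesis
      by (metis inv(2)[OF i] linear_cmul[OF glin] s[OF i] scaleR_one scaleR_scaleR)
  qed
  with a p q_eq show ?thesis
    by (intro bexI[of _ a] bexI[of _ p]) auto
qed

section \<open>Direct sum decomposition of the reversible-equivariant mappings\<close>

theorem theorem4p3:
  fixes \<Gamma> :: "('g, 'm) monoid_scheme"
    and T :: "'g topology"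
    and W :: "'e::euclidean_space set"
    and \<A> :: "('g set \<times> ('g \<Rightarrow> 'e)) set"
    and \<rho> :: "'g \<Rightarrow> 'v::euclidean_space \<Rightarrow> 'v"
    and \<sigma> :: "'g \<Rightarrow> real"
    and X :: "'v \<Rightarrow> 'v"
    and L :: "'v \<Rightarrow>\<^sub>L 'v"
    and k :: nat
  assumes "compact_lie_group \<Gamma> T W \<A>"
    and "linear_action \<Gamma> T \<rho>"
    and "\<sigma> \<in> epi \<Gamma> Z2"
    and "smooth_on UNIV X"
    and "reversible_equivariant \<Gamma> \<rho> \<sigma> X"
    and "X 0 = 0"
    and "(X has_derivative L) (at 0)"
    and "\<And>s \<gamma> x. \<gamma> \<in> carrier \<Gamma> \<Longrightarrow>
      blinfun_exp (s *\<^sub>R blinfun_adjoint L) (\<rho> \<gamma> x) =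
      \<rho> \<gamma> (blinfun_exp ((\<sigma> \<gamma> * s) *\<^sub>R blinfun_adjoint L) x)"
    and "k \<ge> 2"
  shows "is_direct_sum
    (reversible_equivariant_polys k \<Gamma> \<rho> \<sigma>)
    (reversible_equivariant_polys k (S_semidirect L \<Gamma> \<rho>) (semidirect_action \<rho>) (semidirect_sign \<sigma>))
    (Ad L ` equivariant_polys k \<Gamma> \<rho>)"
proof -
  let ?M = "blinfun_adjoint L"
  let ?H = "homogeneous_polys k :: ('v \<Rightarrow> 'v) set"
  let ?Q = "reversible_equivariant_polys k \<Gamma> \<rho> \<sigma>"
  let ?QS = "reversible_equivariant_polys k (S_semidirect L \<Gamma> \<rho>) (semidirect_action \<rho>) (semidirect_sign \<sigma>)"
  let ?P = "equivariant_polys k \<Gamma> \<rho>"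
  interpret \<Gamma>: group_action \<Gamma> UNIV \<rho>
    using assms(2) by (simp add: linear_action_def)
  interpret group \<Gamma>
    using \<Gamma>.group_hom by (simp add: group_hom_def)
  have lin: "bounded_linear (\<rho> \<gamma>)" if "\<gamma> \<in> carrier \<Gamma>" for \<gamma>
    using assms(2) that by (simp add: linear_action_def linear_conv_bounded_linear)
  have inv: "\<rho> (inv\<^bsub>\<Gamma>\<^esub> \<gamma>) (\<rho> \<gamma> x) = x" "\<rho> \<gamma> (\<rho> (inv\<^bsub>\<Gamma>\<^esub> \<gamma>) x) = x" if "\<gamma> \<in> carrier \<Gamma>" for \<gamma> x
    using \<Gamma>.orbit_sym_aux[OF that, of x] \<Gamma>.orbit_sym_aux[of "inv\<^bsub>\<Gamma>\<^esub> \<gamma>" x] that by auto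
  have \<sigma>_sq: "\<sigma> \<gamma> * \<sigma> \<gamma> = 1" if "\<gamma> \<in> carrier \<Gamma>" for \<gamma>
  proof -
    have "\<sigma> \<gamma> \<in> {-1, 1}"
      using assms(3) that by (auto simp: epi_def hom_def Z2_def)
    then show ?thesis by auto
  qed
  have \<sigma>_one: "\<sigma> \<one>\<^bsub>\<Gamma>\<^esub> = 1"
  proof -
    have "\<sigma> (\<one>\<^bsub>\<Gamma>\<^esub> \<otimes>\<^bsub>\<Gamma>\<^esub> \<one>\<^bsub>\<Gamma>\<^esub>) = \<sigma> \<one>\<^bsub>\<Gamma>\<^esub> * \<sigma> \<one>\<^bsub>\<Gamma>\<^esub>"
      using assms(3) one_closed unfolding epi_def hom_def Z2_def by fastforce
    then show ?thesis
      using \<sigma>_sq[OF one_closed] by simp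
  qed
  have \<rho>_one: "\<rho> \<one>\<^bsub>\<Gamma>\<^esub> x = x" for x
    using fun_cong[OF \<Gamma>.id_eq_one, of x] by simp
  \<comment> \<open>Both sides are derivatives at \<open>0\<close> of
    \<open>X (\<rho> \<gamma> x)\<close>, by the chain rule and by the symmetry of
    \<open>X\<close>.\<close>
  have L\<rho>: "L (\<rho> \<gamma> x) = \<sigma> \<gamma> *\<^sub>R \<rho> \<gamma> (L x)" if \<gamma>: "\<gamma> \<in> carrier \<Gamma>" for \<gamma> x
  proof -
    have "\<rho> \<gamma> 0 = 0"
      using linear_0[OF bounded_linear.linear[OF lin[OF \<gamma>]]] .
    then have "((\<lambda>x. X (\<rho> \<gamma> x)) has_derivative (\<lambda>v. L (\<rho> \<gamma> v))) (at 0)"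
      using has_derivative_compose[OF bounded_linear_imp_has_derivative[OF lin[OF \<gamma>]], of X L 0 UNIV]
        assms(7) by simp
    moreover have "((\<lambda>x. X (\<rho> \<gamma> x)) has_derivative (\<lambda>v. \<sigma> \<gamma> *\<^sub>R \<rho> \<gamma> (L v))) (at 0)"
      using has_derivative_scaleR_right[OF bounded_linear.has_derivative[OF lin[OF \<gamma>] assms(7)],
          of "\<sigma> \<gamma>"] assms(5) \<gamma> by (simp add: reversible_equivariant_def)
    ultimately show ?thesis
      by (metis has_derivative_unique)
  qed
  have M\<rho>: "?M (\<rho> \<gamma> x) = \<sigma> \<gamma> *\<^sub>R \<rho> \<gamma> (?M x)" if \<gamma>: "\<gamma> \<in> carrier \<Gamma>" for \<gamma> x
  proof -
    have "((\<lambda>s. blinfun_exp (s *\<^sub>R ?M) (\<rho> \<gamma> x)) has_vector_derivative ?M (\<rho> \<gamma> x)) (at 0)"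
      using blinfun_exp_has_vector_derivative[of ?M "\<rho> \<gamma> x" 0] by simp
    \<comment> \<open>The sign is moved from the time parameter to the generator, so that
      differentiation at \<open>0\<close> gives the factor \<open>\<sigma> \<gamma>\<close>.\<close>
    moreover have "((\<lambda>s. blinfun_exp (s *\<^sub>R \<sigma> \<gamma> *\<^sub>R ?M) x) has_vector_derivative (\<sigma> \<gamma> *\<^sub>R ?M) x) (at 0)"
      using blinfun_exp_has_vector_derivative[of "\<sigma> \<gamma> *\<^sub>R ?M" x 0] by simp
    then have "((\<lambda>s. blinfun_exp (s *\<^sub>R ?M) (\<rho> \<gamma> x)) has_vector_derivative \<rho> \<gamma> ((\<sigma> \<gamma> *\<^sub>R ?M) x)) (at 0)"
      unfolding assms(8)[OF \<gamma>]
      by (intro bounded_linear.has_vector_derivative[OF lin[OF \<gamma>]]) (simp add: mult.commute)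
    ultimately have "?M (\<rho> \<gamma> x) = \<rho> \<gamma> ((\<sigma> \<gamma> *\<^sub>R ?M) x)"
      by (rule vector_derivative_unique_at)
    then show ?thesis
      by (simp add: blinfun.scaleR_left linear_cmul[OF bounded_linear.linear[OF lin[OF \<gamma>]]])
  qed
  have id_in_S: "id_blinfun \<in> carrier (S_group L)"
  proof -
    have "id_blinfun \<in> range (\<lambda>s. blinfun_exp (s *\<^sub>R ?M))"
      by (rule range_eqI[of _ _ 0]) simp
    moreover have "id_blinfun \<in> (GL :: ('v \<Rightarrow>\<^sub>L 'v) set)"
      using blinfun_exp_in_GL[of 0] by simp
    ultimately show ?thesis
      using closure_of_subset_Int[of "top_of_set GL" "range (\<lambda>s. blinfun_exp (s *\<^sub>R ?M))"]
      by (simp add: S_group_def subset_iff)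
  qed
  \<comment> \<open>Taking \<open>A\<close> to be the identity isolates the condition for \<Gamma>,
    and taking \<open>\<gamma>\<close> to be the unit isolates commutation with
    \<open>S_group L\<close>, which is the kernel condition.\<close>
  have QS_iff: "p \<in> ?QS \<longleftrightarrow> p \<in> ?Q \<and> Ad ?M p = (\<lambda>x. 0)" for p
  proof (cases "p \<in> ?H")
    case True
    have "reversible_equivariant (S_semidirect L \<Gamma> \<rho>) (semidirect_action \<rho>) (semidirect_sign \<sigma>) p \<longleftrightarrow>
        (\<forall>A\<in>carrier (S_group L). \<forall>\<gamma>\<in>carrier \<Gamma>. \<forall>x. p (A (\<rho> \<gamma> x)) = \<sigma> \<gamma> *\<^sub>R A (\<rho> \<gamma> (p x)))" (is "?lhs \<longleftrightarrow> ?rhs")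
      by (auto simp: reversible_equivariant_def S_semidirect_def semidirect_product_def
          semidirect_action_def semidirect_sign_def)
    also have "\<dots> \<longleftrightarrow> reversible_equivariant \<Gamma> \<rho> \<sigma> p \<and>
        (\<forall>A\<in>carrier (S_group L). \<forall>x. p (A x) = A (p x))"
    proof (intro iffI conjI ballI allI)
      assume *: ?rhs
      show "reversible_equivariant \<Gamma> \<rho> \<sigma> p"
        unfolding reversible_equivariant_def using *[rule_format, OF id_in_S] by simp
      show "p (A x) = A (p x)" if "A \<in> carrier (S_group L)" for A x
        using *[rule_format, OF that one_closed, of x] by (simp add: \<rho>_one \<sigma>_one)
    qed (auto simp: reversible_equivariant_def blinfun.scaleR_right)
    finally show ?thesis
      using True commutes_S_group_iff[OF homogeneous_polysD(1)[OF True], of L]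
      by (simp add: reversible_equivariant_polys_def)
  qed (simp add: reversible_equivariant_polys_def)
  have map_subspace_Q: "map_subspace ?Q"
    using map_subspace_homogeneous_polys[of k] lin
    by (auto simp: map_subspace_def reversible_equivariant_polys_def reversible_equivariant_def
        linear_0[OF bounded_linear.linear] linear_add[OF bounded_linear.linear]
        linear_cmul[OF bounded_linear.linear] scaleR_add_right)
  have map_subspace_P: "map_subspace ?P"
    using map_subspace_homogeneous_polys[of k] lin
    by (auto simp: map_subspace_def equivariant_polys_def equivariant_def
        linear_0[OF bounded_linear.linear] linear_add[OF bounded_linear.linear]
        linear_cmul[OF bounded_linear.linear])
  have QH: "p \<in> ?Q \<Longrightarrow> polynomial_function p" and PH: "p \<in> ?P \<Longrightarrow> polynomial_function p" for p
    by (auto simp: reversible_equivariant_polys_def equivariant_polys_def homogeneous_polys_def)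
  have Ad_zero: "Ad K (\<lambda>x. 0) = (\<lambda>x. 0)" for K :: "'v \<Rightarrow>\<^sub>L 'v"
    using Ad_scaleR[of "\<lambda>x. 0" K 0] by simp
  have "map_subspace ?QS"
    using map_subspace_Q QH by (auto simp: map_subspace_def QS_iff Ad_add Ad_scaleR Ad_zero)
  moreover have "map_subspace (Ad L ` ?P)"
    unfolding map_subspace_def ball_simps
  proof (intro conjI ballI allI)
    show "(\<lambda>x. 0) \<in> Ad L ` ?P"
      using Ad_zero map_subspaceD(1)[OF map_subspace_P] by (metis image_eqI)
    show "(\<lambda>x. Ad L p x + Ad L q x) \<in> Ad L ` ?P" if "p \<in> ?P" "q \<in> ?P" for p q
      using Ad_add[OF that[THEN PH]] map_subspaceD(2)[OF map_subspace_P that] by (metis image_eqI)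
    show "(\<lambda>x. c *\<^sub>R Ad L p x) \<in> Ad L ` ?P" if "p \<in> ?P" for c p
      using Ad_scaleR[OF that[THEN PH], of L c] map_subspaceD(3)[OF map_subspace_P that, of c]
      by (metis image_eqI)
  qed
  \<comment> \<open>An equivariant \<open>p\<close> equals its own conjugate by
    \<open>\<gamma>\<close>, so \<open>Ad_conjugate\<close> leaves just the sign. This is what
    places the second summand inside \<open>?Q\<close>.\<close>
  moreover have Ad_Q: "Ad L p \<in> ?Q" if "p \<in> ?P" for p
  proof -
    have "p \<in> ?H" and eqv: "\<gamma> \<in> carrier \<Gamma> \<Longrightarrow> p (\<rho> \<gamma> x) = \<rho> \<gamma> (p x)" for \<gamma> x
      using that by (auto simp: equivariant_polys_def equivariant_def)
    have "Ad L p (\<rho> \<gamma> x) = \<sigma> \<gamma> *\<^sub>R \<rho> \<gamma> (Ad L p x)" if \<gamma>: "\<gamma> \<in> carrier \<Gamma>" for \<gamma> x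
    proof -
      have "(\<lambda>x. \<rho> (inv\<^bsub>\<Gamma>\<^esub> \<gamma>) (p (\<rho> \<gamma> x))) = p"
        by (simp add: eqv \<gamma> inv)
      then have "Ad L p x = \<sigma> \<gamma> *\<^sub>R \<rho> (inv\<^bsub>\<Gamma>\<^esub> \<gamma>) (Ad L p (\<rho> \<gamma> x))"
        using fun_cong[OF Ad_conjugate[OF homogeneous_polysD(1)[OF \<open>p \<in> ?H\<close>] lin[OF \<gamma>]
              lin[OF inv_closed[OF \<gamma>]] inv[OF \<gamma>] \<sigma>_sq[OF \<gamma>] L\<rho>[OF \<gamma>]], of x] by simp
      then show ?thesis
        by (simp add: linear_cmul[OF bounded_linear.linear[OF lin[OF \<gamma>]]] inv \<gamma> \<sigma>_sq)
    qed
    then show ?thesis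
      using Ad_homogeneous[OF \<open>p \<in> ?H\<close>]
      by (simp add: reversible_equivariant_polys_def reversible_equivariant_def)
  qed
  have "?Q = {(\<lambda>x. f x + f' x) | f f'. f \<in> ?QS \<and> f' \<in> Ad L ` ?P}"
  proof (intro equalityI subsetI)
    fix q assume "q \<in> ?Q"
    then have q: "q \<in> ?H" "\<gamma> \<in> carrier \<Gamma> \<Longrightarrow> q (\<rho> \<gamma> x) = \<sigma> \<gamma> *\<^sub>R \<rho> \<gamma> (q x)" for \<gamma> x
      by (auto simp: reversible_equivariant_polys_def reversible_equivariant_def)
    have "\<exists>a\<in>?H. \<exists>p\<in>?H. Ad ?M a = (\<lambda>x. 0) \<and> q = (\<lambda>x. a x + Ad L p x) \<and>
        (\<forall>\<gamma>\<in>carrier \<Gamma>. \<forall>x. a (\<rho> \<gamma> x) = \<sigma> \<gamma> *\<^sub>R \<rho> \<gamma> (a x)) \<and>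
        (\<forall>\<gamma>\<in>carrier \<Gamma>. \<forall>x. p (\<rho> \<gamma> x) = \<rho> \<gamma> (p x))"
      by (rule Ad_covariant_splitting[of L ?M "carrier \<Gamma>" \<rho> "\<lambda>\<gamma>. \<rho> (inv\<^bsub>\<Gamma>\<^esub> \<gamma>)" \<sigma> q k])
        (fact inner_blinfun_adjoint lin lin[OF inv_closed] inv \<sigma>_sq L\<rho> M\<rho> q)+
    then obtain a p where ap: "a \<in> ?H" "p \<in> ?H" "Ad ?M a = (\<lambda>x. 0)" "q = (\<lambda>x. a x + Ad L p x)"
      "\<forall>\<gamma>\<in>carrier \<Gamma>. \<forall>x. a (\<rho> \<gamma> x) = \<sigma> \<gamma> *\<^sub>R \<rho> \<gamma> (a x)"
      "\<forall>\<gamma>\<in>carrier \<Gamma>. \<forall>x. p (\<rho> \<gamma> x) = \<rho> \<gamma> (p x)"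
      by (elim bexE conjE)
    have "a \<in> ?QS"
      using ap(1,3,5) unfolding QS_iff
      by (simp add: reversible_equivariant_polys_def reversible_equivariant_def)
    moreover have "p \<in> ?P"
      using ap(2,6) by (simp add: equivariant_polys_def equivariant_def)
    ultimately show "q \<in> {(\<lambda>x. f x + f' x) | f f'. f \<in> ?QS \<and> f' \<in> Ad L ` ?P}"
      using ap(4) by blast
  qed (use Ad_Q map_subspaceD(2)[OF map_subspace_Q] QS_iff in auto)
  moreover have "?QS \<inter> Ad L ` ?P = {\<lambda>x. 0}"
  proof (intro equalityI subsetI)
    \<comment> \<open>Membership in \<open>?QS\<close> puts \<open>f\<close> in the kernel of
      \<open>Ad ?M\<close>, which meets the image of \<open>Ad L\<close> only in zero.\<close>
    fix f assume "f \<in> ?QS \<inter> Ad L ` ?P"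
    then obtain p where "p \<in> ?H" "f = Ad L p" "Ad ?M (Ad L p) = (\<lambda>x. 0)"
      by (auto simp: QS_iff equivariant_polys_def)
    then show "f \<in> {\<lambda>x. 0}"
      using Ad_kernel_image_trivial[OF inner_blinfun_adjoint] by auto
  qed (use calculation map_subspaceD(1) in auto)
  ultimately show ?thesis
    unfolding is_direct_sum_def by blast
qed

end
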